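(* Let $\{\phi_n\in L^\infty(0,1): n=1,2,\ldots\}$ be a basis in $L^p(0,1)$, $1<p<\infty$, and let $\varepsilon>0$. Then there exists an open set $G\subset(0,1)$ with $|G|<\varepsilon$ such that for any $f\in L^1(0,1)$ one can find a function $g\in L^1(0,1)$ whose Fourier series in $\{\phi_n\}$ converges in $L^1$-norm and such that $\{x: g(x)\neq f(x)\}\subset G$.
   Context: $|G|$ denotes Lebesgue measure. A basis in $L^p(0,1)$ is a Schauder basis: every $h\in L^p(0,1)$ has a unique expansion $h=\sum_{n}c_n(h)\phi_n$ converging in $L^p$-norm, with coefficients $c_n(h)=\int_0^1 h\psi_n$, where $\{\psi_n\}$ is the system biorthogonal to $\{\phi_n\}$. The Fourier series of a function $g$ in $\{\phi_n\}$ is the series $\sum_{n=1}^\infty c_n(g)\phi_n$ with $c_n(g)=\int_0^1 g\psi_n$. *)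

theory Defs
  imports "HOL-Analysis.Analysis"
begin

text \<open>
  Functions on \<open>(0,1)\<close> are represented by total functions on \<open>real\<close> whose values outside
  \<open>(0,1)\<close> are irrelevant; members of the Lebesgue spaces are functions, not classes modulo null
  sets. Scalars range over a type of class \<open>{real_normed_field, euclidean_space}\<close>, which covers
  exactly the real and the complex case.
\<close>

abbreviation unit_leb :: "real measure" where
  "unit_leb \<equiv> lebesgue_on {0<..<1}"

definition Lp :: "real \<Rightarrow> (real \<Rightarrow> 'a::euclidean_space) set" where
  "Lp p = {f \<in> borel_measurable unit_leb. integrable unit_leb (\<lambda>x. norm (f x) powr p)}"

definition Linf :: "(real \<Rightarrow> 'a::euclidean_space) set" where
  "Linf = {f \<in> borel_measurable unit_leb. \<exists>C. AE x in unit_leb. norm (f x) \<le> C}"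

definition Lp_norm :: "real \<Rightarrow> (real \<Rightarrow> 'a::euclidean_space) \<Rightarrow> real" where
  "Lp_norm p f = (LINT x|unit_leb. norm (f x) powr p) powr (1 / p)"

definition series_converges_Lp ::
    "real \<Rightarrow> (nat \<Rightarrow> real \<Rightarrow> 'a::{real_normed_field, euclidean_space}) \<Rightarrow> (nat \<Rightarrow> 'a) \<Rightarrow> (real \<Rightarrow> 'a) \<Rightarrow> bool" where
  "series_converges_Lp p \<phi> c h \<longleftrightarrow>
     (\<lambda>N. Lp_norm p (\<lambda>x. (\<Sum>n<N. c n * \<phi> n x) - h x)) \<longlonglongrightarrow> 0"

definition schauder_basis_Lp ::
    "real \<Rightarrow> (nat \<Rightarrow> real \<Rightarrow> 'a::{real_normed_field, euclidean_space}) \<Rightarrow> bool" where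
  "schauder_basis_Lp p \<phi> \<longleftrightarrow>
     (\<forall>n. \<phi> n \<in> Lp p) \<and> (\<forall>h\<in>Lp p. \<exists>!c. series_converges_Lp p \<phi> c h)"

definition fourier_coeff ::
    "(nat \<Rightarrow> real \<Rightarrow> 'a::{real_normed_field, euclidean_space}) \<Rightarrow> (real \<Rightarrow> 'a) \<Rightarrow> nat \<Rightarrow> 'a" where
  "fourier_coeff \<psi> g n = (LINT x|unit_leb. g x * \<psi> n x)"

text \<open>
  The dual system lies in the dual space \<open>L\<^sup>q\<close>, \<open>q = p / (p - 1)\<close>. If \<open>\<phi>\<close> is a basis of \<open>L\<^sup>p\<close>, then
  such a system exists and is unique up to null sets, and the coefficients of the expansion
  of \<open>h \<in> L\<^sup>p\<close> are its \<open>fourier_coeff\<close>s.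
\<close>

definition biorthogonal_system_Lp ::
    "real \<Rightarrow> (nat \<Rightarrow> real \<Rightarrow> 'a::{real_normed_field, euclidean_space}) \<Rightarrow> (nat \<Rightarrow> real \<Rightarrow> 'a) \<Rightarrow> bool" where
  "biorthogonal_system_Lp p \<phi> \<psi> \<longleftrightarrow>
     (\<forall>n. \<psi> n \<in> Lp (p / (p - 1))) \<and>
     (\<forall>m n. (LINT x|unit_leb. \<phi> m x * \<psi> n x) = (if m = n then 1 else 0))"

text \<open>
  Since \<open>\<psi> n\<close> need not be bounded, \<open>g \<in> L\<^sup>1\<close> alone does not make the Fourier coefficients of \<open>g\<close>
  meaningful; having a Fourier series therefore includes the integrability of each \<open>g \<psi>\<^sub>n\<close>
  (the Bochner integral of a non-integrable function is \<open>0\<close> by convention).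
\<close>

definition has_fourier_series ::
    "(nat \<Rightarrow> real \<Rightarrow> 'a::{real_normed_field, euclidean_space}) \<Rightarrow> (real \<Rightarrow> 'a) \<Rightarrow> bool" where
  "has_fourier_series \<psi> g \<longleftrightarrow> (\<forall>n. integrable unit_leb (\<lambda>x. g x * \<psi> n x))"

end

theory Submission
  imports Defs
begin

text \<open>
  Only the following consequence of the basis property matters: for bounded \<open>h\<close> the partial sums
  \<open>S\<^sub>N h\<close> converge to \<open>h\<close> in \<open>L\<^sup>1\<close>. By a uniform boundedness argument, \<open>sup\<^sub>N \<parallel>S\<^sub>N h\<parallel>\<^sub>1\<close> is then small
  whenever \<open>h\<close> is bounded by a fixed constant and supported on a set of small measure.

  Let \<open>r\<close> be bounded and supported where every \<open>\<psi>\<^sub>n\<close> is bounded. Cut the interval into small pieces \<open>D\<close>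
  and on each of them replace \<open>r\<close> by \<open>h = r (1\<^sub>D - 1\<^sub>E / c)\<close> with \<open>E \<subseteq> D\<close>, \<open>|E| = c |D|\<close>, where \<open>E\<close> is
  spread so evenly that the first coefficients of \<open>h\<close> nearly vanish. Treating the pieces successively,
  each with negligible coefficients as long as the expansions of the preceding pieces have not
  stabilised, one obtains \<open>g\<close> with \<open>g = r\<close> off a set of measure at most \<open>c\<close> and
  \<open>\<parallel>S\<^sub>N g\<parallel>\<^sub>1 \<le> 3 \<parallel>r\<parallel>\<^sub>1\<close> for all \<open>N\<close>.

  Do this for a countable dense family of functions \<open>r\<^sub>k\<close> with exceptional sets of summable measure; \<open>G\<close> is an
  open set covering all of them and the sets where some \<open>\<psi>\<^sub>n\<close> is large. An arbitrary \<open>f\<close> is off \<open>G\<close>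
  an \<open>L\<^sup>1\<close>-absolutely convergent sum of functions \<open>r\<^sub>k\<close>, and \<open>g\<close> is the sum of their corrections.
\<close>

section \<open>Hoelder estimates and the expansion of a function in \<open>L\<^sup>p\<close>\<close>

lemma (in finite_measure) integrable_of_powr:
  fixes u :: "'a \<Rightarrow> 'b::{banach,second_countable_topology}"
  assumes "1 \<le> p" "u \<in> borel_measurable M" "integrable M (\<lambda>x. norm (u x) powr p)"
  shows "integrable M u"
proof (rule Bochner_Integration.integrable_bound)
  show "integrable M (\<lambda>x. 1 + norm (u x) powr p)"
    using assms by auto
  have "y \<le> 1 + y powr p" if "0 \<le> y" for y :: real
  proof (cases "y \<le> 1")
    case False
    then have "y powr 1 \<le> y powr p" using assms(1) by (intro powr_mono) auto
    with False show ?thesis by simp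
  qed (simp add: add_increasing2)
  then show "AE x in M. norm (u x) \<le> norm (1 + norm (u x) powr p)"
    by (intro AE_I2) (simp add: abs_of_nonneg add_nonneg_nonneg)
qed (use assms in auto)

text \<open>Young's inequality for \<open>inverse t * a\<close> and \<open>t * b\<close>. The free
  scale \<open>t\<close> shifts weight between the two terms, which is all that the limits of
  products below require.\<close>

lemma young_scaled:
  fixes a b p q t :: real
  assumes "1 < p" "1 < q" "1/p + 1/q = 1" "0 \<le> a" "0 \<le> b" "0 < t"
  shows "a * b \<le> (inverse t powr p / p) * a powr p + (t powr q / q) * b powr q"
proof -
  have "(inverse t * a) * (t * b) \<le> (inverse t * a) powr p / p + (t * b) powr q / q"
    using assms by (intro Youngs_inequality) auto
  moreover have "(inverse t * a) * (t * b) = a * b" using assms by (simp add: field_simps)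
  moreover have "(inverse t * a) powr p = inverse t powr p * a powr p" "(t * b) powr q = t powr q * b powr q"
    using assms by (simp_all add: powr_mult)
  ultimately show ?thesis by simp
qed

lemma integrable_mult_of_powr:
  fixes u v :: "'a \<Rightarrow> 'b::{real_normed_field, euclidean_space}"
  assumes pq: "1 < p" "1 < q" "1/p + 1/q = 1"
    and u: "u \<in> borel_measurable M" "integrable M (\<lambda>x. norm (u x) powr p)"
    and v: "v \<in> borel_measurable M" "integrable M (\<lambda>x. norm (v x) powr q)"
  shows "integrable M (\<lambda>x. u x * v x)"
proof (rule Bochner_Integration.integrable_bound)
  show "integrable M (\<lambda>x. (1/p) * norm (u x) powr p + (1/q) * norm (v x) powr q)"
    using u v by auto
  have "norm (u x) * norm (v x) \<le> norm ((1/p) * norm (u x) powr p + (1/q) * norm (v x) powr q)" for x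
    using young_scaled[of p q "norm (u x)" "norm (v x)" 1] pq by simp
  then show "AE x in M. norm (u x * v x) \<le> norm ((1/p) * norm (u x) powr p + (1/q) * norm (v x) powr q)"
    by (simp add: norm_mult)
qed (use u v in auto)

lemma tendsto_integral_mult_of_powr:
  fixes u :: "nat \<Rightarrow> 'a \<Rightarrow> 'b::{real_normed_field, euclidean_space}"
  assumes pq: "1 < p" "1 < q" "1/p + 1/q = 1"
    and u: "\<And>n. u n \<in> borel_measurable M" "\<And>n. integrable M (\<lambda>x. norm (u n x) powr p)"
    and v: "v \<in> borel_measurable M" "integrable M (\<lambda>x. norm (v x) powr q)"
    and lim: "(\<lambda>n. LINT x|M. norm (u n x) powr p) \<longlonglongrightarrow> 0"
  shows "(\<lambda>n. LINT x|M. norm (u n x * v x)) \<longlonglongrightarrow> 0"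
proof (rule LIMSEQ_I)
  fix e :: real assume e: "0 < e"
  define V where "V = (LINT x|M. norm (v x) powr q)"
  have V0: "0 \<le> V" by (simp add: V_def)
  \<comment> \<open>This scale pushes the \<open>v\<close>-term of \<open>young_scaled\<close> below
    e/2; with \<open>t\<close> fixed, the \<open>u\<close>-term tends to 0. The summand 1 keeps the
    denominator positive when \<open>V = 0\<close>.\<close>
  define t where "t = (e * q / (2 * (V + 1))) powr (1/q)"
  have t0: "0 < t" using e pq V0 by (simp add: t_def)
  have tq: "t powr q = e * q / (2 * (V + 1))" using e pq V0 by (simp add: t_def powr_powr)
  have tV: "(t powr q / q) * V < e / 2"
  proof -
    have "(t powr q / q) * V = e / 2 * (V / (V + 1))" using tq pq V0 by (simp add: field_simps)
    also have "\<dots> < e / 2 * 1" using e V0 by (intro mult_strict_left_mono) auto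
    finally show ?thesis by simp
  qed
  have "(\<lambda>n. (inverse t powr p / p) * (LINT x|M. norm (u n x) powr p)) \<longlonglongrightarrow> 0"
    using tendsto_mult_right_zero[OF lim] .
  from order_tendstoD(2)[OF this half_gt_zero[OF e]] obtain N where
    N: "\<And>n. n \<ge> N \<Longrightarrow> (inverse t powr p / p) * (LINT x|M. norm (u n x) powr p) < e / 2"
    unfolding eventually_sequentially by blast
  have "(LINT x|M. norm (u n x * v x)) < e" if "n \<ge> N" for n
  proof -
    have "(LINT x|M. norm (u n x * v x)) \<le>
      (LINT x|M. (inverse t powr p / p) * norm (u n x) powr p + (t powr q / q) * norm (v x) powr q)"
      using young_scaled[OF pq _ _ t0] integrable_norm[OF integrable_mult_of_powr[OF pq u v]] u v
      by (intro integral_mono) (auto simp: norm_mult)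
    also have "\<dots> = (inverse t powr p / p) * (LINT x|M. norm (u n x) powr p) + (t powr q / q) * V"
      using u v by (simp add: V_def)
    also have "\<dots> < e" using N[OF that] tV by linarith
    finally show ?thesis .
  qed
  then show "\<exists>no. \<forall>n\<ge>no. norm ((LINT x|M. norm (u n x * v x)) - 0) < e" by auto
qed

text \<open>Being built from integrals against \<open>\<psi>\<close>, it makes sense for every
  \<open>h\<close>, whether or not \<open>h\<close> has an expansion. Coefficients with a
  non-integrable integrand are 0 by convention, so additivity in \<open>h\<close> is available only
  under integrability hypotheses.\<close>

definition partial_sum :: "'b measure \<Rightarrow> (nat \<Rightarrow> 'b \<Rightarrow> 'a) \<Rightarrow> (nat \<Rightarrow> 'b \<Rightarrow> 'a) \<Rightarrow> nat \<Rightarrow> ('b \<Rightarrow> 'a) \<Rightarrow>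
    'b \<Rightarrow> 'a::{real_normed_field, euclidean_space}" where
  "partial_sum M \<phi> \<psi> N h x = (\<Sum>n<N. (LINT y|M. h y * \<psi> n y) * \<phi> n x)"

section \<open>Lebesgue spaces on the unit interval\<close>

lemma finite_measure_unit_leb: "finite_measure unit_leb"
  by (rule finite_measure_lebesgue_on) auto

lemma integrable_of_Lp: "1 \<le> p \<Longrightarrow> f \<in> Lp p \<Longrightarrow> integrable unit_leb f"
  using finite_measure.integrable_of_powr[OF finite_measure_unit_leb] unfolding Lp_def by blast

lemma bounded_in_Lp:
  assumes "0 \<le> p" "h \<in> borel_measurable unit_leb" "\<And>x. norm (h x) \<le> C"
  shows "h \<in> Lp p"
proof -
  interpret finite_measure unit_leb by (rule finite_measure_unit_leb)
  have "integrable unit_leb (\<lambda>x. norm (h x) powr p)"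
    using assms by (intro integrable_const_bound[where B="C powr p"] AE_I2) (auto intro: powr_mono2)
  with assms show ?thesis by (simp add: Lp_def)
qed

lemma Lp_add: assumes "0 < p" "f \<in> Lp p" "g \<in> Lp p" shows "(\<lambda>x. f x + g x) \<in> Lp p"
proof -
  have le: "norm (a + b) powr p \<le> 2 powr p * (norm a powr p + norm b powr p)" for a b :: 'a
  proof -
    have "norm (a + b) \<le> 2 * max (norm a) (norm b)" using norm_triangle_ineq[of a b] by linarith
    then have "norm (a + b) powr p \<le> (2 * max (norm a) (norm b)) powr p"
      using assms by (intro powr_mono2) auto
    also have "\<dots> = 2 powr p * (max (norm a) (norm b)) powr p" by (simp add: powr_mult)
    also have "\<dots> \<le> 2 powr p * (norm a powr p + norm b powr p)" by (intro mult_left_mono) (auto simp: max_def)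
    finally show ?thesis .
  qed
  have "integrable unit_leb (\<lambda>x. norm (f x + g x) powr p)"
  proof (rule Bochner_Integration.integrable_bound)
    show "integrable unit_leb (\<lambda>x. 2 powr p * (norm (f x) powr p + norm (g x) powr p))"
      using assms by (simp add: Lp_def)
    show "AE x in unit_leb. norm (norm (f x + g x) powr p) \<le> norm (2 powr p * (norm (f x) powr p + norm (g x) powr p))"
      using order_trans[OF le abs_ge_self] by (intro AE_I2) (simp del: abs_mult)
  qed (use assms in \<open>auto simp: Lp_def\<close>)
  then show ?thesis using assms by (auto simp: Lp_def)
qed

lemma Lp_cmult:
  fixes f :: "real \<Rightarrow> 'a::{real_normed_field, euclidean_space}"
  assumes "f \<in> Lp p" shows "(\<lambda>x. c * f x) \<in> Lp p"
  using assms by (auto simp: Lp_def norm_mult powr_mult)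

lemma Lp_zero: "(\<lambda>x. 0) \<in> Lp p" by (auto simp: Lp_def)

lemma Lp_sum:
  assumes "0 < p" "\<And>n. n < N \<Longrightarrow> f n \<in> Lp p" shows "(\<lambda>x. \<Sum>n<N::nat. f n x) \<in> Lp p"
  using assms(2) by (induction N) (auto intro: Lp_zero Lp_add[OF assms(1)])

text \<open>Let \<open>u N\<close> be the error of the expansion supplied by the basis. Its pairing
  with \<open>\<psi> n\<close> tends to 0, yet by biorthogonality it is constant once
  \<open>n < N\<close>; this identifies the coefficients. Pairing \<open>u N\<close> with the
  constant 1, which lies in the dual space, then gives convergence in L1.\<close>

lemma partial_sum_converges_L1:
  fixes \<phi> \<psi> :: "nat \<Rightarrow> real \<Rightarrow> 'a::{real_normed_field, euclidean_space}"
  assumes p: "1 < p" and basis: "schauder_basis_Lp p \<phi>" and bio: "biorthogonal_system_Lp p \<phi> \<psi>"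
    and h: "h \<in> Lp p"
  shows "(\<lambda>N. LINT x|unit_leb. norm (partial_sum unit_leb \<phi> \<psi> N h x - h x)) \<longlonglongrightarrow> 0"
proof -
  define q where "q = p / (p - 1)"
  have q: "1 < q" "1/p + 1/q = 1" using p by (auto simp: q_def field_simps)
  have \<phi>: "\<phi> n \<in> Lp p" for n using basis by (auto simp: schauder_basis_Lp_def)
  have \<psi>: "\<psi> n \<in> Lp q" for n using bio by (auto simp: biorthogonal_system_Lp_def q_def)
  obtain c where c: "series_converges_Lp p \<phi> c h"
    using basis h by (auto simp: schauder_basis_Lp_def)
  define u where "u = (\<lambda>N x. (\<Sum>n<N. c n * \<phi> n x) - h x)"
  have u: "u N \<in> Lp p" for N
    using Lp_add[OF _ Lp_sum[of p N "\<lambda>n x. c n * \<phi> n x"] Lp_cmult[OF h, of "-1"]] p \<phi>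
    by (auto simp: u_def Lp_cmult)
  have "(\<lambda>N. ((LINT x|unit_leb. norm (u N x) powr p) powr (1/p)) powr p) \<longlonglongrightarrow> 0 powr p"
    using c p unfolding series_converges_Lp_def Lp_norm_def u_def
    by (intro tendsto_powr') auto
  then have lim: "(\<lambda>N. LINT x|unit_leb. norm (u N x) powr p) \<longlonglongrightarrow> 0"
    using p by (simp add: powr_powr)
  have dual: "(\<lambda>N. LINT x|unit_leb. norm (u N x * v x)) \<longlonglongrightarrow> 0" if "v \<in> Lp q" for v
    using that u lim by (intro tendsto_integral_mult_of_powr[OF p q]) (auto simp: Lp_def)
  have prod: "integrable unit_leb (\<lambda>x. f x * v x)" if "f \<in> Lp p" "v \<in> Lp q" for f v :: "real \<Rightarrow> 'a"
    using that by (intro integrable_mult_of_powr[OF p q]) (auto simp: Lp_def)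
  have coeff: "c n = (LINT x|unit_leb. h x * \<psi> n x)" for n
  proof -
    have "(LINT x|unit_leb. u N x * \<psi> n x) = c n - (LINT x|unit_leb. h x * \<psi> n x)" if "n < N" for N
    proof -
      have "(LINT x|unit_leb. u N x * \<psi> n x)
          = (LINT x|unit_leb. (\<Sum>m<N. c m * (\<phi> m x * \<psi> n x)) - h x * \<psi> n x)"
        by (simp add: u_def sum_distrib_right left_diff_distrib mult.assoc)
      also have "\<dots> = (\<Sum>m<N. c m * (LINT x|unit_leb. \<phi> m x * \<psi> n x)) - (LINT x|unit_leb. h x * \<psi> n x)"
        using prod[OF \<phi> \<psi>] prod[OF h \<psi>] by simp
      also have "(\<Sum>m<N. c m * (LINT x|unit_leb. \<phi> m x * \<psi> n x)) = (\<Sum>m<N. if m = n then c m else 0)"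
        using bio by (intro sum.cong) (auto simp: biorthogonal_system_Lp_def)
      also have "\<dots> = c n" using that by simp
      finally show ?thesis .
    qed
    then have "eventually (\<lambda>N. norm (c n - (LINT x|unit_leb. h x * \<psi> n x)) \<le> (LINT x|unit_leb. norm (u N x * \<psi> n x))) sequentially"
      by (intro eventually_sequentiallyI[of "Suc n"]) (metis integral_norm_bound Suc_le_eq)
    then have "norm (c n - (LINT x|unit_leb. h x * \<psi> n x)) \<le> 0"
      by (intro tendsto_lowerbound[OF dual[OF \<psi>]]) auto
    then show ?thesis by simp
  qed
  have "(\<lambda>x. 1::'a) \<in> Lp q" using q by (intro bounded_in_Lp[where C=1]) auto
  from dual[OF this] show ?thesis by (simp add: u_def partial_sum_def coeff)
qed

section \<open>Partial sums of functions with small support\<close>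

text \<open>Absolute continuity of the integral: the norm of \<open>f\<close> is at most
  \<open>n\<close> plus its excess over \<open>n\<close>. For large \<open>n\<close> the excess has
  integral below e/2 by dominated convergence, and the remaining part costs at most \<open>n\<close>
  times the measure of \<open>A\<close>.\<close>

lemma (in finite_measure) integral_small_sets:
  fixes f :: "'a \<Rightarrow> 'b::{banach,second_countable_topology}"
  assumes f: "integrable M f" and e: "0 < e"
  shows "\<exists>\<tau>>0. \<forall>A\<in>sets M. measure M A \<le> \<tau> \<longrightarrow> (LINT x|M. indicator A x * norm (f x)) \<le> e"
proof -
  have "(\<lambda>n. LINT x|M. max (norm (f x) - real n) 0) \<longlonglongrightarrow> (LINT x|M. 0)"
  proof (rule integral_dominated_convergence[where w="\<lambda>x. norm (f x)"])
    show "AE x in M. (\<lambda>n. max (norm (f x) - real n) 0) \<longlonglongrightarrow> 0"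
    proof (intro AE_I2 tendsto_eventually)
      fix x
      obtain m where "norm (f x) \<le> real m" using real_arch_simple by blast
      then show "eventually (\<lambda>n. max (norm (f x) - real n) 0 = 0) sequentially"
        by (intro eventually_sequentiallyI[of m]) auto
    qed
  qed (use f in auto)
  then have "(\<lambda>n. LINT x|M. max (norm (f x) - real n) 0) \<longlonglongrightarrow> 0" by simp
  from eventually_happens[OF order_tendstoD(2)[OF this half_gt_zero[OF e]]] obtain n where
    n: "(LINT x|M. max (norm (f x) - real n) 0) < e / 2" by auto
  have "(LINT x|M. indicator A x * norm (f x)) \<le> e"
    if A: "A \<in> sets M" "measure M A \<le> e / (2 * (real n + 1))" for A
  proof -
    have i: "integrable M (\<lambda>x. max (norm (f x) - real n) 0)"
      using f by (intro Bochner_Integration.integrable_bound[OF integrable_norm[OF f]] AE_I2) auto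
    have "(LINT x|M. indicator A x * norm (f x)) \<le> (LINT x|M. max (norm (f x) - real n) 0 + real n * indicator A x)"
    proof (rule integral_mono)
      show "integrable M (\<lambda>x. indicator A x * norm (f x))"
        using integrable_mult_indicator[OF A(1) integrable_norm[OF f]] by simp
    qed (use A i in \<open>auto split: split_indicator simp: emeasure_eq_measure\<close>)
    also have "\<dots> = (LINT x|M. max (norm (f x) - real n) 0) + real n * measure M A"
      using i A by (simp add: emeasure_eq_measure)
    also have "real n * measure M A \<le> e / 2"
    proof -
      have "real n * measure M A \<le> (real n + 1) * (e / (2 * (real n + 1)))"
        using A(2) by (intro mult_mono) auto
      also have "\<dots> = e / 2" by (simp add: divide_simps)
      finally show ?thesis .
    qed
    finally show ?thesis using n by simp
  qed
  moreover have "0 < e / (2 * (real n + 1))" using e by simp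
  ultimately show ?thesis by blast
qed

text \<open>Collects what the construction draws on. \<open>divisible\<close> expresses that the
  measure has no atoms; \<open>converges\<close> speaks of bounded functions only, so the exponent
  of the original space no longer appears.\<close>

locale L1_expansion = finite_measure M for M :: "'b measure" +
  fixes \<phi> \<psi> :: "nat \<Rightarrow> 'b \<Rightarrow> 'a::{real_normed_field, euclidean_space}"
  assumes integrable_\<phi>: "integrable M (\<phi> n)"
    and integrable_\<psi>: "integrable M (\<psi> n)"
    and divisible: "A \<in> sets M \<Longrightarrow> 0 \<le> c \<Longrightarrow> c \<le> 1 \<Longrightarrow> \<exists>E\<in>sets M. E \<subseteq> A \<and> measure M E = c * measure M A"
    and converges: "h \<in> borel_measurable M \<Longrightarrow> (\<And>x. norm (h x) \<le> C) \<Longrightarrow>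
      (\<lambda>N. LINT x|M. norm (partial_sum M \<phi> \<psi> N h x - h x)) \<longlonglongrightarrow> 0"
begin

section \<open>Elementary L1 estimates for partial sums\<close>

abbreviation "S \<equiv> partial_sum M \<phi> \<psi>"
abbreviation "L1 f \<equiv> LINT x|M. norm (f x)"

lemma integrable_S [simp, intro]: "integrable M (S N h)"
  unfolding partial_sum_def[abs_def] using integrable_\<phi> by auto

lemma L1_triangle:
  fixes f g :: "'b \<Rightarrow> 'a"
  assumes "integrable M f" "integrable M g" shows "L1 (\<lambda>x. f x + g x) \<le> L1 f + L1 g"
proof -
  have "L1 (\<lambda>x. f x + g x) \<le> (LINT x|M. norm (f x) + norm (g x))"
    using assms by (intro integral_mono) (auto intro: norm_triangle_ineq)
  also have "\<dots> = L1 f + L1 g" using assms by simp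
  finally show ?thesis .
qed

lemma L1_triangle_diff:
  fixes f g :: "'b \<Rightarrow> 'a"
  assumes "integrable M f" "integrable M g" shows "L1 (\<lambda>x. f x - g x) \<le> L1 f + L1 g"
  using L1_triangle[of f "\<lambda>x. - g x"] assms by simp

lemma L1_S_le: "L1 (S N h) \<le> (\<Sum>n<N. norm (LINT x|M. h x * \<psi> n x) * L1 (\<phi> n))"
proof -
  have "L1 (S N h) \<le> (LINT x|M. (\<Sum>n<N. norm (LINT x|M. h x * \<psi> n x) * norm (\<phi> n x)))"
    unfolding partial_sum_def using integrable_\<phi>
    by (intro integral_mono integrable_norm) (auto simp flip: norm_mult intro: norm_sum)
  also have "\<dots> = (\<Sum>n<N. norm (LINT x|M. h x * \<psi> n x) * L1 (\<phi> n))"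
    using integrable_\<phi> by simp
  finally show ?thesis .
qed

lemma integrable_bounded_mult:
  assumes "h \<in> borel_measurable M" "\<And>x. norm (h x) \<le> C"
  shows "integrable M (\<lambda>x. h x * \<psi> n x)"
proof (rule Bochner_Integration.integrable_bound)
  show "integrable M (\<lambda>x. C * norm (\<psi> n x))" using integrable_\<psi> by simp
  have "0 \<le> C" using assms(2) norm_ge_zero order_trans by blast
  then show "AE x in M. norm (h x * \<psi> n x) \<le> norm (C * norm (\<psi> n x))"
    using assms by (intro AE_I2) (simp add: norm_mult abs_mult mult_right_mono)
qed (use assms integrable_\<psi> in auto)

lemma integrable_bounded:
  assumes "h \<in> borel_measurable M" "\<And>x. norm (h x) \<le> C"
  shows "integrable M (h :: 'b \<Rightarrow> 'a)"
  using assms by (intro integrable_const_bound[where B=C]) auto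

lemma S_add:
  assumes "\<And>n. integrable M (\<lambda>x. h x * \<psi> n x)" "\<And>n. integrable M (\<lambda>x. k x * \<psi> n x)"
  shows "S N (\<lambda>x. h x + k x) = (\<lambda>x. S N h x + S N k x)"
  using assms by (simp add: partial_sum_def fun_eq_iff distrib_right sum.distrib)

lemma S_diff:
  assumes "\<And>n. integrable M (\<lambda>x. h x * \<psi> n x)" "\<And>n. integrable M (\<lambda>x. k x * \<psi> n x)"
  shows "S N (\<lambda>x. h x - k x) = (\<lambda>x. S N h x - S N k x)"
  using assms by (simp add: partial_sum_def fun_eq_iff left_diff_distrib sum_subtractf)

text \<open>Finitely many coefficients are involved, and each is small by absolute continuity of the
  integral of \<open>\<psi> n\<close>. The threshold \<open>\<tau>\<close> depends on
  \<open>N\<close> here; removing this dependence is the task of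
  \<open>S_small_uniform\<close>.\<close>

lemma S_small_fixed:
  assumes C: "0 < C" and e: "0 < e"
  shows "\<exists>\<tau>>0. \<forall>h A. h \<in> borel_measurable M \<longrightarrow> A \<in> sets M \<longrightarrow> measure M A \<le> \<tau> \<longrightarrow>
     (\<forall>x. norm (h x) \<le> C * indicator A x) \<longrightarrow> (\<forall>n\<le>N. L1 (S n h) \<le> e)"
proof -
  define K where "K = C * (\<Sum>n<N. L1 (\<phi> n)) + 1"
  have K: "0 < K" using C by (auto simp: K_def intro!: add_nonneg_pos mult_nonneg_nonneg sum_nonneg)
  have "\<forall>n. \<exists>\<tau>>0. \<forall>A\<in>sets M. measure M A \<le> \<tau> \<longrightarrow> (LINT x|M. indicator A x * norm (\<psi> n x)) \<le> e / K"
    using integral_small_sets[OF integrable_\<psi>] e K by simp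
  then obtain \<tau> where \<tau>: "\<And>n. 0 < \<tau> n"
    "\<And>n A. A\<in>sets M \<Longrightarrow> measure M A \<le> \<tau> n \<Longrightarrow> (LINT x|M. indicator A x * norm (\<psi> n x)) \<le> e / K"
    by metis
  define t where "t = Min (\<tau> ` {..N})"
  have t: "0 < t" "\<And>n. n \<le> N \<Longrightarrow> t \<le> \<tau> n" using \<tau>(1) by (auto simp: t_def)
  have "L1 (S n h) \<le> e" if h: "h \<in> borel_measurable M" "A \<in> sets M" "measure M A \<le> t"
    "\<And>x. norm (h x) \<le> C * indicator A x" and n: "n \<le> N" for h A n
  proof -
    have hC: "norm (h x) \<le> C" for x using h(4)[of x] C by (auto split: split_indicator_asm)
    have c: "norm (LINT x|M. h x * \<psi> m x) \<le> C * (e / K)" if "m \<le> N" for m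
    proof -
      have "norm (LINT x|M. h x * \<psi> m x) \<le> (LINT x|M. norm (h x * \<psi> m x))" by (rule integral_norm_bound)
      also have "\<dots> \<le> (LINT x|M. C * (indicator A x * norm (\<psi> m x)))"
      proof (rule integral_mono)
        show "integrable M (\<lambda>x. norm (h x * \<psi> m x))" using integrable_bounded_mult[OF h(1) hC] by simp
        show "integrable M (\<lambda>x. C * (indicator A x * norm (\<psi> m x)))"
          using integrable_mult_indicator[OF h(2) integrable_norm[OF integrable_\<psi>]] by simp
        show "norm (h x * \<psi> m x) \<le> C * (indicator A x * norm (\<psi> m x))" for x
          using mult_right_mono[OF h(4)[of x] norm_ge_zero[of "\<psi> m x"]] by (simp add: norm_mult mult.assoc)
      qed
      also have "\<dots> = C * (LINT x|M. indicator A x * norm (\<psi> m x))" by simp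
      also have "\<dots> \<le> C * (e / K)"
        using \<tau>(2)[OF h(2)] h(3) t(2)[OF that] C by (intro mult_left_mono) auto
      finally show ?thesis .
    qed
    have "L1 (S n h) \<le> (\<Sum>m<n. norm (LINT x|M. h x * \<psi> m x) * L1 (\<phi> m))" by (rule L1_S_le)
    also have "\<dots> \<le> (\<Sum>m<N. norm (LINT x|M. h x * \<psi> m x) * L1 (\<phi> m))"
      using n by (intro sum_mono2) auto
    also have "\<dots> \<le> (\<Sum>m<N. (C * (e / K)) * L1 (\<phi> m))"
      using c by (intro sum_mono mult_right_mono) auto
    also have "\<dots> = (C * (\<Sum>m<N. L1 (\<phi> m))) * (e / K)"
      by (simp only: sum_distrib_left[symmetric] mult_ac)
    also have "\<dots> = (K - 1) * (e / K)" by (simp add: K_def)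
    also have "\<dots> \<le> K * (e / K)" using e K by (intro mult_right_mono) auto
    also have "\<dots> = e" using K by simp
    finally show ?thesis .
  qed
  then show ?thesis using t(1) by blast
qed

text \<open>
  A uniform boundedness principle, proved by a gliding hump: were it false, modifying a bounded
  function successively on sets \<open>A k\<close> of rapidly decreasing measure would produce a bounded
  function with divergent expansion. At each stage the modification is either by the offending
  function or by \<open>0\<close> on \<open>A k\<close>; their partial sums differ by more than \<open>e\<close>, so one of them is bad.
\<close>

lemma S_small_uniform:
  assumes C: "0 < C" and e: "0 < e"
  shows "\<exists>\<tau>>0. \<forall>h A N. h \<in> borel_measurable M \<longrightarrow> A \<in> sets M \<longrightarrow> measure M A \<le> \<tau> \<longrightarrow>
     (\<forall>x. norm (h x) \<le> C * indicator A x) \<longrightarrow> L1 (S N h) \<le> e"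
proof (rule ccontr)
  assume neg: "\<not> ?thesis"
  have bad: "\<exists>h A N. h \<in> borel_measurable M \<and> A \<in> sets M \<and> measure M A \<le> \<tau> \<and>
     (\<forall>x. norm (h x) \<le> C * indicator A x) \<and> e < L1 (S N h)" if "0 < \<tau>" for \<tau>
    using neg that by (auto simp: not_le)
  \<comment> \<open>The factor 2 is there because this will be applied to the difference of two
    functions bounded by \<open>C\<close>.\<close>
  define good where "good N \<tau> \<longleftrightarrow> (\<forall>h A. h \<in> borel_measurable M \<longrightarrow> A \<in> sets M \<longrightarrow> measure M A \<le> \<tau> \<longrightarrow>
     (\<forall>x. norm (h x) \<le> (2 * C) * indicator A x) \<longrightarrow> (\<forall>n\<le>N. L1 (S n h) \<le> e / 8))" for N \<tau>
  have ex_good: "\<exists>\<tau>>0. good N \<tau>" for N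
    using S_small_fixed[of "2 * C" "e / 8" N] C e unfolding good_def by auto
  have good_mono: "good N s" if "good N t" "s \<le> t" for N s t
    using that unfolding good_def by (meson order_trans)
  \<comment> \<open>A state consists of the current function \<open>H\<close>, the last index
    \<open>N\<close> treated and a budget \<open>t\<close>: all later changes together will take
    place on a set of measure at most \<open>t\<close>. By \<open>good N t\<close> they then alter
    the partial sums up to index \<open>N\<close> by at most e/8.\<close>
  define ok where "ok = (\<lambda>(H, N, t). (H :: 'b \<Rightarrow> 'a) \<in> borel_measurable M \<and> (\<forall>x. norm (H x) \<le> C) \<and> 0 < t \<and> good N t)"
  define step where "step = (\<lambda>(H :: 'b \<Rightarrow> 'a, N :: nat, t :: real) (H' :: 'b \<Rightarrow> 'a, N', t'). N < N' \<and> t' \<le> t / 2 \<and>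
     (\<exists>A\<in>sets M. measure M A \<le> t / 2 \<and> (\<forall>x. x \<notin> A \<longrightarrow> H' x = H x)) \<and> e / 2 \<le> L1 (\<lambda>x. S N' H' x - H x))"
  have "\<exists>X. \<forall>k. ok (X k) \<and> step (X k) (X (Suc k))"
  proof (rule dependent_nat_choice)
    obtain t where "0 < t" "good 0 t" using ex_good by blast
    then show "\<exists>X. ok X" using C unfolding ok_def by (intro exI[of _ "(\<lambda>x. 0, 0, t)"]) auto
  next
    fix X and k :: nat assume "ok X"
    then obtain H N t where X: "X = (H, N, t)" and H: "H \<in> borel_measurable M" "\<And>x. norm (H x) \<le> C"
      and t: "0 < t" "good N t" by (auto simp: ok_def)
    obtain h A N' where h: "h \<in> borel_measurable M" "A \<in> sets M" "measure M A \<le> t / 2"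
      "\<And>x. norm (h x) \<le> C * indicator A x" "e < L1 (S N' h)"
      using bad[of "t / 2"] t(1) by auto
    \<comment> \<open>On so small a set the partial sums up to index \<open>N\<close> are at most
      e/8, so the offending index lies beyond \<open>N\<close>.\<close>
    have "N < N'"
    proof (rule ccontr)
      assume "\<not> N < N'"
      moreover have "norm (h x) \<le> (2 * C) * indicator A x" for x
        using h(4)[of x] C by (auto split: split_indicator_asm)
      ultimately have "L1 (S N' h) \<le> e / 8" using t h unfolding good_def by auto
      then show False using h(5) e by simp
    qed
    define K where "K b x = (if x \<in> A then if b then h x else 0 else H x)" for b x
    have h0: "x \<notin> A \<Longrightarrow> h x = 0" and hC: "norm (h x) \<le> C" for x
      using h(4)[of x] C by (auto split: split_indicator_asm)
    have Km: "K b \<in> borel_measurable M" for b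
      unfolding K_def using h H by (auto intro!: measurable_If_set)
    have Kb: "norm (K b x) \<le> C" for b x using hC H(2) C by (auto simp: K_def)
    have "h = (\<lambda>x. K True x - K False x)" using h0 by (auto simp: K_def fun_eq_iff)
    then have "S N' h = (\<lambda>x. S N' (K True) x - S N' (K False) x)"
      using S_diff[OF integrable_bounded_mult[OF Km Kb] integrable_bounded_mult[OF Km Kb]] by metis
    then have "L1 (S N' h) = L1 (\<lambda>x. (S N' (K True) x - H x) - (S N' (K False) x - H x))" by simp
    also have "\<dots> \<le> L1 (\<lambda>x. S N' (K True) x - H x) + L1 (\<lambda>x. S N' (K False) x - H x)"
      using integrable_bounded[OF H] by (intro L1_triangle_diff) auto
    finally have "e / 2 \<le> L1 (\<lambda>x. S N' (K True) x - H x) \<or> e / 2 \<le> L1 (\<lambda>x. S N' (K False) x - H x)"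
      using h(5) by linarith
    then obtain b where b: "e / 2 \<le> L1 (\<lambda>x. S N' (K b) x - H x)" by blast
    obtain t0 where t0: "0 < t0" "good N' t0" using ex_good by blast
    have "ok (K b, N', min t0 (t / 2))"
      using Km Kb t0 t good_mono[OF t0(2)] by (auto simp: ok_def)
    moreover have "step X (K b, N', min t0 (t / 2))"
      unfolding step_def X using b \<open>N < N'\<close> h by (auto simp: K_def intro!: bexI[of _ A])
    ultimately show "\<exists>X'. ok X' \<and> step X X'" by blast
  qed
  then obtain X where X: "\<And>k. ok (X k)" "\<And>k. step (X k) (X (Suc k))" by blast
  define H where "H k = fst (X k)" for k
  define N where "N k = fst (snd (X k))" for k
  define t where "t k = snd (snd (X k))" for k
  have Xeq: "X k = (H k, N k, t k)" for k by (simp add: H_def N_def t_def)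
  have Hm [measurable]: "H k \<in> borel_measurable M" and HC: "norm (H k x) \<le> C" and t0: "0 < t k" and gd: "good (N k) (t k)" for k x
    using X(1)[of k] by (auto simp: Xeq ok_def)
  have N: "N k < N (Suc k)" and tt: "t (Suc k) \<le> t k / 2"
    and ebad: "e / 2 \<le> L1 (\<lambda>x. S (N (Suc k)) (H (Suc k)) x - H k x)"
    and "\<exists>A\<in>sets M. measure M A \<le> t k / 2 \<and> (\<forall>x. x \<notin> A \<longrightarrow> H (Suc k) x = H k x)" for k
    using X(2)[of k] by (auto simp: Xeq step_def)
  then obtain A where A [measurable]: "\<And>k. A k \<in> sets M" and At: "\<And>k. measure M (A k) \<le> t k / 2"
    and AH: "\<And>k x. x \<notin> A k \<Longrightarrow> H (Suc k) x = H k x" by metis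
  define V where "V k = (\<Union>i. A (k + i))" for k
  have V [measurable]: "V k \<in> sets M" for k by (auto simp: V_def)
  have tk: "t (k + i) \<le> t k * (1/2) ^ i" for k i
  proof (induction i)
    case (Suc i) then show ?case using tt[of "k + i"] by simp
  qed simp
  \<comment> \<open>Each change uses at most half of the current budget and the budgets at least
    halve, so a geometric series bounds all changes from stage \<open>k\<close> on by
    \<open>t k\<close>.\<close>
  have Vt: "measure M (V k) \<le> t k" for k
  proof -
    have le: "measure M (A (k + i)) \<le> (t k / 2) * (1/2) ^ i" for i using At[of "k + i"] tk[of k i] by simp
    have sm: "summable (\<lambda>i. (t k / 2) * (1/2) ^ i)" by (intro summable_mult summable_geometric) simp
    have "summable (\<lambda>i. measure M (A (k + i)))"
      using le by (intro summable_comparison_test'[OF sm]) simp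
    then have "measure M (V k) \<le> (\<Sum>i. measure M (A (k + i)))"
      unfolding V_def by (intro finite_measure_subadditive_countably) auto
    also have "\<dots> \<le> (\<Sum>i. (t k / 2) * (1/2) ^ i)"
      using le by (intro suminf_le sm \<open>summable (\<lambda>i. measure M (A (k + i)))\<close>) auto
    also have "\<dots> = t k" by (subst suminf_mult) (auto simp: suminf_geometric summable_geometric)
    finally show ?thesis .
  qed
  have HV: "H (k + i) x = H k x" if "x \<notin> V k" for k i x
    using that AH by (induction i) (auto simp: V_def)
  \<comment> \<open>Off \<open>V k\<close> the sequence is constant from stage \<open>k\<close> on.
    The points lying in infinitely many \<open>A k\<close> form a null set, on which the value 0
    keeps \<open>h\<close> bounded.\<close>
  define h where "h x = (if x \<in> (\<Inter>k. V k) then 0 else lim (\<lambda>k. H k x))" for x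
  have hH: "h x = H k x" if "x \<notin> V k" for k x
  proof -
    have "(\<lambda>i. H (i + k) x) \<longlonglongrightarrow> H k x" using HV[OF that] by (simp add: add.commute)
    then have "(\<lambda>i. H i x) \<longlonglongrightarrow> H k x" by (rule LIMSEQ_offset)
    then show ?thesis using that by (auto simp: h_def limI)
  qed
  have hm [measurable]: "h \<in> borel_measurable M"
    unfolding h_def by (intro measurable_If_set borel_measurable_lim_metric) auto
  have hC: "norm (h x) \<le> C" for x
  proof (cases "x \<in> (\<Inter>k. V k)")
    case False then show ?thesis using hH HC by (metis INT_I)
  qed (use C in \<open>auto simp: h_def\<close>)
  have diffm: "(\<lambda>x. h x - H k x) \<in> borel_measurable M" for k by measurable
  have diffb: "norm (h x - H k x) \<le> (2 * C) * indicator (V k) x" for k x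
    using hH[of x k] norm_triangle_ineq4[of "h x" "H k x"] hC[of x] HC[of k x] by (auto split: split_indicator)
  have d1: "L1 (\<lambda>x. h x - H k x) \<le> 2 * C * t k" for k
  proof -
    have "L1 (\<lambda>x. h x - H k x) \<le> (LINT x|M. (2 * C) * indicator (V k) x)"
      using diffb[of _ k] integrable_bounded[OF Hm HC] integrable_bounded[OF hm hC]
      by (intro integral_mono integrable_mult_right) (auto simp: emeasure_eq_measure)
    also have "\<dots> = 2 * C * measure M (V k)" by simp
    finally show ?thesis using Vt[of k] C by (meson mult_left_mono order_trans mult_nonneg_nonneg less_imp_le zero_le_numeral)
  qed
  have d2: "L1 (S (N k) (\<lambda>x. h x - H k x)) \<le> e / 8" for k
    using gd[of k] diffm diffb V Vt unfolding good_def by blast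
  \<comment> \<open>At index \<open>N (Suc k)\<close> the bad function \<open>H (Suc k)\<close> is
    replaced by \<open>h\<close>, at a cost of e/8 by goodness, and the comparison function
    \<open>H k\<close> by \<open>h\<close>, at a cost of at most \<open>2 * C * t k\<close>. As
    \<open>k\<close> grows this leaves e/2 at most e/8.\<close>
  have key: "e / 2 \<le> L1 (\<lambda>x. S (N (Suc k)) h x - h x) + e / 8 + 2 * C * t k" for k
  proof -
    let ?n = "N (Suc k)" and ?K = "H (Suc k)"
    have i: "integrable M h" "integrable M (H k)"
      using integrable_bounded[OF Hm HC] integrable_bounded[OF hm hC] by auto
    have "S ?n (\<lambda>x. h x - ?K x) = (\<lambda>x. S ?n h x - S ?n ?K x)"
      by (intro S_diff integrable_bounded_mult[OF Hm HC] integrable_bounded_mult[OF hm hC])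
    then have "L1 (\<lambda>x. S ?n ?K x - H k x) = L1 (\<lambda>x. ((S ?n h x - h x) + (h x - H k x)) - S ?n (\<lambda>x. h x - ?K x) x)"
      by simp
    also have "\<dots> \<le> L1 (\<lambda>x. (S ?n h x - h x) + (h x - H k x)) + L1 (S ?n (\<lambda>x. h x - ?K x))"
      using i by (intro L1_triangle_diff) auto
    also have "L1 (\<lambda>x. (S ?n h x - h x) + (h x - H k x)) \<le> L1 (\<lambda>x. S ?n h x - h x) + L1 (\<lambda>x. h x - H k x)"
      using i by (intro L1_triangle) auto
    finally show ?thesis using ebad[of k] d1[of k] d2[of "Suc k"] by linarith
  qed
  have "strict_mono N" using N by (simp add: strict_mono_Suc_iff)
  then have "(\<lambda>k. L1 (\<lambda>x. S (N (Suc k)) h x - h x)) \<longlonglongrightarrow> 0"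
    using LIMSEQ_subseq_LIMSEQ[OF converges[OF hm hC] \<open>strict_mono N\<close>] LIMSEQ_Suc by (fastforce simp: o_def)
  moreover have "t \<longlonglongrightarrow> 0"
  proof (rule tendsto_sandwich[where f="\<lambda>_. 0"])
    show "(\<lambda>k. t 0 * (1/2) ^ k) \<longlonglongrightarrow> 0" by (intro tendsto_mult_right_zero LIMSEQ_power_zero) auto
    show "eventually (\<lambda>k. t k \<le> t 0 * (1/2) ^ k) sequentially" using tk[of 0] by simp
  qed (use t0 in \<open>auto simp: less_imp_le\<close>)
  ultimately have "(\<lambda>k. L1 (\<lambda>x. S (N (Suc k)) h x - h x) + e / 8 + 2 * C * t k) \<longlonglongrightarrow> 0 + e / 8 + 2 * C * 0"
    by (intro tendsto_intros)
  then have "e / 2 \<le> 0 + e / 8 + 2 * C * 0"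
    by (rule LIMSEQ_le_const) (use key in auto)
  then show False using e by simp
qed

subsection \<open>Correction of a bounded function\<close>

lemma integrable_indicator_bounded:
  fixes u :: "'b \<Rightarrow> 'a"
  assumes "A \<in> sets M" "u \<in> borel_measurable M" "\<And>x. norm (u x) \<le> B"
  shows "integrable M (\<lambda>x. indicator A x *\<^sub>R u x)"
  using assms by (intro integrable_mult_indicator integrable_bounded)

text \<open>
  An approximate form of Lyapunov's convexity theorem: cut \<open>D\<close> into pieces on which all \<open>u n\<close> are
  nearly constant, and take the proportion \<open>c\<close> of each piece.
\<close>

lemma proportional_subset:
  fixes u :: "nat \<Rightarrow> 'b \<Rightarrow> 'a"
  assumes um: "\<And>n. n < N \<Longrightarrow> u n \<in> borel_measurable M"
    and ub: "\<And>n x. n < N \<Longrightarrow> norm (u n x) \<le> B"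
    and c: "0 < c" "c \<le> 1" and \<delta>: "0 < \<delta>" and D: "D \<in> sets M"
  shows "\<exists>E\<in>sets M. E \<subseteq> D \<and> measure M E = c * measure M D \<and>
    (\<forall>n<N. norm ((LINT x|M. indicator D x *\<^sub>R u n x) - (1 / c) *\<^sub>R (LINT x|M. indicator E x *\<^sub>R u n x))
       \<le> \<delta> * measure M D)"
proof -
  \<comment> \<open>\<open>good D\<close> is the claim for \<open>D\<close>. It passes to disjoint
    unions because both sides of the estimate are additive, so it suffices to reach pieces on which
    all \<open>u n\<close> are nearly constant.\<close>
  define good where "good D \<longleftrightarrow> (\<exists>E\<in>sets M. E \<subseteq> D \<and> measure M E = c * measure M D \<and>
    (\<forall>n<N. norm ((LINT x|M. indicator D x *\<^sub>R u n x) - (1 / c) *\<^sub>R (LINT x|M. indicator E x *\<^sub>R u n x))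
       \<le> \<delta> * measure M D))" for D
  define near where "near n D \<longleftrightarrow> (\<exists>y. \<forall>x\<in>D. norm (u n x - y) \<le> \<delta> / 2)" for n D
  have int: "integrable M (\<lambda>x. indicator A x *\<^sub>R u n x)" if "A \<in> sets M" "n < N" for A n
    using that um ub by (intro integrable_indicator_bounded[where B=B]) auto
  have good_Un: "good (D1 \<union> D2)" if D12: "D1 \<in> sets M" "D2 \<in> sets M" "D1 \<inter> D2 = {}" and g: "good D1" "good D2" for D1 D2
  proof -
    obtain E1 where E1: "E1 \<in> sets M" "E1 \<subseteq> D1" "measure M E1 = c * measure M D1"
      "\<And>n. n < N \<Longrightarrow> norm ((LINT x|M. indicator D1 x *\<^sub>R u n x) - (1 / c) *\<^sub>R (LINT x|M. indicator E1 x *\<^sub>R u n x))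
       \<le> \<delta> * measure M D1" using g(1) unfolding good_def by auto
    obtain E2 where E2: "E2 \<in> sets M" "E2 \<subseteq> D2" "measure M E2 = c * measure M D2"
      "\<And>n. n < N \<Longrightarrow> norm ((LINT x|M. indicator D2 x *\<^sub>R u n x) - (1 / c) *\<^sub>R (LINT x|M. indicator E2 x *\<^sub>R u n x))
       \<le> \<delta> * measure M D2" using g(2) unfolding good_def by auto
    have disj: "E1 \<inter> E2 = {}" using E1 E2 D12 by auto
    have split: "(LINT x|M. indicator (A \<union> A') x *\<^sub>R u n x)
        = (LINT x|M. indicator A x *\<^sub>R u n x) + (LINT x|M. indicator A' x *\<^sub>R u n x)"
      if "A \<in> sets M" "A' \<in> sets M" "A \<inter> A' = {}" "n < N" for A A' n
      using int that by (subst Bochner_Integration.integral_add[symmetric])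
        (auto simp: indicator_add[OF that(3)] scaleR_add_left[symmetric])
    have mD: "measure M (D1 \<union> D2) = measure M D1 + measure M D2"
      using D12 by (intro finite_measure_Union) auto
    have "measure M (E1 \<union> E2) = c * measure M (D1 \<union> D2)"
      using E1 E2 disj mD by (simp add: finite_measure_Union algebra_simps)
    moreover have "norm ((LINT x|M. indicator (D1 \<union> D2) x *\<^sub>R u n x) - (1 / c) *\<^sub>R (LINT x|M. indicator (E1 \<union> E2) x *\<^sub>R u n x))
       \<le> \<delta> * measure M (D1 \<union> D2)" if n: "n < N" for n
    proof -
      have "(LINT x|M. indicator (D1 \<union> D2) x *\<^sub>R u n x) - (1 / c) *\<^sub>R (LINT x|M. indicator (E1 \<union> E2) x *\<^sub>R u n x)
        = ((LINT x|M. indicator D1 x *\<^sub>R u n x) - (1 / c) *\<^sub>R (LINT x|M. indicator E1 x *\<^sub>R u n x))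
        + ((LINT x|M. indicator D2 x *\<^sub>R u n x) - (1 / c) *\<^sub>R (LINT x|M. indicator E2 x *\<^sub>R u n x))"
        using split[OF D12 n] split[OF E1(1) E2(1) disj n] by (simp add: scaleR_add_right)
      also have "norm \<dots> \<le> \<delta> * measure M D1 + \<delta> * measure M D2"
        by (intro norm_triangle_le add_mono E1(4) E2(4) n)
      finally show ?thesis by (simp add: mD algebra_simps)
    qed
    ultimately show ?thesis unfolding good_def using E1 E2 by (intro bexI[of _ "E1 \<union> E2"]) auto
  qed
  have good_near: "good D" if D: "D \<in> sets M" and near: "\<And>n. n < N \<Longrightarrow> near n D" for D
  proof -
    obtain E where E: "E \<in> sets M" "E \<subseteq> D" "measure M E = c * measure M D"
      using divisible[OF D, of c] c by auto
    have "norm ((LINT x|M. indicator D x *\<^sub>R u n x) - (1 / c) *\<^sub>R (LINT x|M. indicator E x *\<^sub>R u n x)) \<le> \<delta> * measure M D"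
      if n: "n < N" for n
    proof -
      obtain y where y: "\<And>x. x \<in> D \<Longrightarrow> norm (u n x - y) \<le> \<delta> / 2" using near[OF n] by (auto simp: near_def)
      \<comment> \<open>Replacing \<open>u n\<close> by the constant \<open>y\<close> costs half of
        the tolerance on \<open>D\<close>, and on \<open>E\<close> again half: the factor 1/c is
        compensated by the proportion \<open>c\<close> of \<open>E\<close>. For constants the two
        integrals agree exactly.\<close>
      have dev: "norm ((LINT x|M. indicator A x *\<^sub>R u n x) - measure M A *\<^sub>R y) \<le> \<delta> / 2 * measure M A"
        if A: "A \<in> sets M" "A \<subseteq> D" for A
      proof -
        have iy: "integrable M (\<lambda>x. indicator A x *\<^sub>R y)"
          using A by (intro integrable_scaleR_left) (auto simp: emeasure_eq_measure)
        have "(LINT x|M. indicator A x *\<^sub>R u n x) - measure M A *\<^sub>R y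
          = (LINT x|M. indicator A x *\<^sub>R u n x - indicator A x *\<^sub>R y)"
          using int[OF A(1) n] iy A(1) by (simp add: emeasure_eq_measure)
        also have "norm \<dots> \<le> (LINT x|M. norm (indicator A x *\<^sub>R u n x - indicator A x *\<^sub>R y))"
          by (rule integral_norm_bound)
        also have "\<dots> \<le> (LINT x|M. \<delta> / 2 * indicator A x)"
          using int[OF A(1) n] iy A y by (intro integral_mono)
            (auto simp: emeasure_eq_measure split: split_indicator)
        also have "\<dots> = \<delta> / 2 * measure M A" using A by simp
        finally show ?thesis .
      qed
      have mE: "(1 / c) *\<^sub>R (measure M E *\<^sub>R y) = measure M D *\<^sub>R y" using E(3) c by simp
      have "(LINT x|M. indicator D x *\<^sub>R u n x) - (1 / c) *\<^sub>R (LINT x|M. indicator E x *\<^sub>R u n x)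
        = ((LINT x|M. indicator D x *\<^sub>R u n x) - measure M D *\<^sub>R y)
          - (1 / c) *\<^sub>R ((LINT x|M. indicator E x *\<^sub>R u n x) - measure M E *\<^sub>R y)"
        unfolding scaleR_diff_right mE by simp
      also have "norm \<dots> \<le> norm ((LINT x|M. indicator D x *\<^sub>R u n x) - measure M D *\<^sub>R y)
          + norm ((1 / c) *\<^sub>R ((LINT x|M. indicator E x *\<^sub>R u n x) - measure M E *\<^sub>R y))"
        by (rule norm_triangle_ineq4)
      also have "\<dots> \<le> \<delta> / 2 * measure M D + (1 / c) * (\<delta> / 2 * measure M E)"
        using dev[OF D] mult_left_mono[OF dev[OF E(1,2)], of "1 / c"] c
        unfolding norm_scaleR by (intro add_mono) simp_all
      also have "\<dots> = \<delta> * measure M D" using E(3) c by simp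
      finally show ?thesis .
    qed
    then show ?thesis unfolding good_def using E by blast
  qed
  \<comment> \<open>Induction on the number of functions not yet known to be nearly constant on
    \<open>D\<close>: those of index at least \<open>k\<close> are, and \<open>u k\<close> is the
    next to be treated when passing to \<open>Suc k\<close>.\<close>
  have "\<forall>D\<in>sets M. (\<forall>n. k \<le> n \<longrightarrow> n < N \<longrightarrow> near n D) \<longrightarrow> good D" if "k \<le> N" for k
    using that
  proof (induction k)
    case 0 then show ?case using good_near by auto
  next
    case (Suc k)
    then have k: "k < N" by simp
    have IH: "good D" if "D \<in> sets M" "\<And>n. k \<le> n \<Longrightarrow> n < N \<Longrightarrow> near n D" for D
      using Suc that by auto
    \<comment> \<open>The inner induction peels off the part of \<open>D\<close> that
      \<open>u k\<close> maps into one ball of a finite cover. There \<open>u k\<close> is nearly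
      constant and the outer hypothesis applies.\<close>
    have cover: "good D" if "finite Y" "D \<in> sets M" "\<And>n. Suc k \<le> n \<Longrightarrow> n < N \<Longrightarrow> near n D"
      "u k ` D \<subseteq> (\<Union>y\<in>Y. ball y (\<delta> / 2))" for Y D
      using that
    proof (induction Y arbitrary: D rule: finite_induct)
      case empty
      then show ?case by (auto simp: good_def)
    next
      case (insert y Y)
      define D1 where "D1 = D \<inter> (u k -` ball y (\<delta> / 2) \<inter> space M)"
      have D1: "D1 \<in> sets M" unfolding D1_def
        using um[OF k] insert.prems(1) by (intro sets.Int measurable_sets) auto
      have "near n D1" if "k \<le> n" "n < N" for n
      proof (cases "n = k")
        case True
        have "norm (u k x - y) \<le> \<delta> / 2" if "x \<in> D1" for x
          using that by (auto simp: D1_def dist_norm norm_minus_commute less_imp_le)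
        then show ?thesis unfolding near_def True by blast
      next
        case False
        with that have "near n D" by (intro insert.prems(2)) auto
        then show ?thesis unfolding near_def D1_def by auto
      qed
      then have "good D1" by (intro IH D1)
      moreover have "good (D - D1)"
      proof (rule insert.IH)
        show "near n (D - D1)" if "Suc k \<le> n" "n < N" for n
          using insert.prems(2)[OF that] unfolding near_def by auto
        show "u k ` (D - D1) \<subseteq> (\<Union>y\<in>Y. ball y (\<delta> / 2))"
          using insert.prems(3) sets.sets_into_space[OF insert.prems(1)] by (auto simp: D1_def)
      qed (use insert.prems D1 in auto)
      ultimately have "good (D1 \<union> (D - D1))" using D1 insert.prems(1) by (intro good_Un) auto
      moreover have "D1 \<union> (D - D1) = D" by (auto simp: D1_def)
      ultimately show ?case by simp
    qed
    have "compact (cball (0::'a) B)" by simp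
    then obtain Y where "finite Y" and Y: "cball (0::'a) B \<subseteq> (\<Union>y\<in>Y. ball y (\<delta> / 2))"
      using \<delta> unfolding compact_eq_totally_bounded by (meson half_gt_zero)
    have "u k x \<in> cball 0 B" for x using ub[OF k] by simp
    then show ?case using cover[OF \<open>finite Y\<close>] Y by blast
  qed
  from this[of N] D have "good D" by auto
  then show ?thesis unfolding good_def .
qed

text \<open>Compensating \<open>r\<close> on \<open>D\<close> by -r/c on an evenly spread part of
  proportion \<open>c\<close> makes finitely many coefficients almost vanish and at most about
  doubles the L1-norm. This accounts for two of the three units of \<open>L1 r\<close> in the bound;
  the third absorbs the accumulated errors and the single piece whose partial sums are in
  transition.\<close>

lemma correction:
  assumes r: "r \<in> borel_measurable M" "\<And>x. norm (r x) \<le> B"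
    and r\<psi>: "\<And>n. \<exists>K. \<forall>x. r x \<noteq> 0 \<longrightarrow> norm (\<psi> n x) \<le> K"
    and c: "0 < c" "c \<le> 1"
  shows "\<exists>g E. g \<in> borel_measurable M \<and> (\<exists>C. \<forall>x. norm (g x) \<le> C) \<and> E \<in> sets M \<and>
    measure M E \<le> c * measure M (space M) \<and> (\<forall>x\<in>space M - E. g x = r x) \<and>
    (\<forall>x. r x = 0 \<longrightarrow> g x = 0) \<and> (\<forall>N. L1 (S N g) \<le> 3 * L1 r)"
proof (cases "L1 r = 0")
  \<comment> \<open>Treated apart because the tolerance \<open>\<eta> / 4\<close> used below must be
    positive. Here \<open>r\<close> vanishes almost everywhere and is its own correction.\<close>
  case True
  then have "AE x in M. r x = 0"
    using integral_nonneg_eq_0_iff_AE[OF integrable_norm[OF integrable_bounded[OF r]]] by simp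
  then have "(LINT x|M. r x * \<psi> n x) = 0" for n by (intro integral_eq_zero_AE) auto
  then have "S N r = (\<lambda>x. 0)" for N by (simp add: partial_sum_def fun_eq_iff)
  then show ?thesis using r c by (intro exI[of _ r] exI[of _ "{}"]) auto
next
  case False
  define \<eta> where "\<eta> = L1 r"
  have \<eta>: "0 < \<eta>" using False by (simp add: \<eta>_def less_le)
  have B: "0 \<le> B" using r(2) norm_ge_zero order_trans by blast
  \<comment> \<open>Bounds each corrected piece, and so their sum as well, since the pieces have
    disjoint supports. Using \<open>B + 1\<close> makes \<open>C\<close> positive.\<close>
  define C where "C = (B + 1) * (1 + 1 / c)"
  have C: "0 < C" unfolding C_def using B c by (intro mult_pos_pos add_nonneg_pos add_pos_pos) auto
  obtain \<tau> where \<tau>: "0 < \<tau>" "\<And>h A N. h \<in> borel_measurable M \<Longrightarrow> A \<in> sets M \<Longrightarrow> measure M A \<le> \<tau> \<Longrightarrow>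
     (\<And>x. norm (h x) \<le> C * indicator A x) \<Longrightarrow> L1 (S N h) \<le> \<eta> / 4"
    using S_small_uniform[OF C, of "\<eta> / 4"] \<eta> by auto
  \<comment> \<open>\<open>m\<close> pieces of measure at most \<open>\<tau>\<close> suffice for the
    whole space, and \<open>e\<close> is chosen so that an error of \<open>2 * e\<close> for each
    piece adds up to at most \<open>\<eta> / 4\<close>.\<close>
  obtain m where m: "measure M (space M) / \<tau> \<le> real m" using real_arch_simple by blast
  define e where "e = \<eta> / (8 * (real m + 1))"
  have e: "0 < e" using \<eta> by (simp add: e_def)
  have me: "real m * (2 * e) \<le> \<eta> / 4"
  proof -
    have "real m * (2 * e) \<le> (real m + 1) * (2 * e)" using e by (intro mult_right_mono) auto
    also have "\<dots> = \<eta> / 4" by (simp add: e_def divide_simps)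
    finally show ?thesis .
  qed
  let ?I = "\<lambda>D x. indicator D x *\<^sub>R r x"
  have intI: "integrable M (?I D)" if "D \<in> sets M" for D
    using that r by (rule integrable_indicator_bounded)
  \<comment> \<open>A piece of measure at most \<open>\<tau>\<close> is appended so late in the expansion that, for each \<open>N\<close>, at most one
    piece has partial sums that are neither negligible nor close to the piece itself.\<close>
  have block: "\<exists>g E N0. g \<in> borel_measurable M \<and> (\<forall>x. norm (g x) \<le> C) \<and> E \<in> sets M \<and> E \<subseteq> D \<and>
      measure M E \<le> c * measure M D \<and> (\<forall>x. x \<notin> E \<longrightarrow> g x = ?I D x) \<and> (\<forall>x. r x = 0 \<longrightarrow> g x = 0) \<and>
      (\<forall>N. L1 (S N g) \<le> 2 * L1 (?I D) + real n * (2 * e) + \<eta> / 4) \<and>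
      (\<forall>N\<ge>N0. L1 (S N g) \<le> 2 * L1 (?I D) + real n * (2 * e))"
    if "D \<in> sets M" "measure M D \<le> real n * \<tau>" for n D
    using that
  proof (induction n arbitrary: D)
    case 0
    then have "measure M D = 0" by (simp add: measure_le_0_iff)
    moreover have "S N (\<lambda>x. 0) = (\<lambda>x. 0)" for N by (simp add: partial_sum_def fun_eq_iff)
    ultimately show ?case using 0 C \<eta>
      by (intro exI[of _ "\<lambda>x. 0"] exI[of _ D] exI[of _ 0]) (auto simp: sets.sets_into_space)
  next
    case (Suc n)
    \<comment> \<open>This proportion leaves at most \<open>real n * \<tau>\<close> for the
      induction hypothesis and at most \<open>\<tau>\<close> for the new piece
      \<open>D2\<close>.\<close>
    obtain D1 where D1: "D1 \<in> sets M" "D1 \<subseteq> D" "measure M D1 = (real n / real (Suc n)) * measure M D"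
      using divisible[OF Suc.prems(1), of "real n / real (Suc n)"] by auto
    define D2 where "D2 = D - D1"
    have D2: "D2 \<in> sets M" "D2 \<subseteq> D" "D1 \<inter> D2 = {}" using D1 Suc.prems by (auto simp: D2_def)
    have mD: "measure M D2 = measure M D - measure M D1"
      using D1 Suc.prems by (simp add: D2_def finite_measure_Diff)
    have D1\<tau>: "measure M D1 \<le> real n * \<tau>"
    proof -
      have "measure M D1 \<le> (real n / real (Suc n)) * (real (Suc n) * \<tau>)"
        unfolding D1(3) using Suc.prems(2) by (intro mult_left_mono) auto
      then show ?thesis by simp
    qed
    have D2\<tau>: "measure M D2 \<le> \<tau>"
    proof -
      have "measure M D2 = measure M D / real (Suc n)" unfolding mD D1(3) by (simp add: field_simps)
      also have "\<dots> \<le> \<tau>" using Suc.prems(2) by (simp add: divide_le_eq mult.commute)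
      finally show ?thesis .
    qed
    obtain g1 E1 N0 where g1: "g1 \<in> borel_measurable M" "\<And>x. norm (g1 x) \<le> C"
      and E1: "E1 \<in> sets M" "E1 \<subseteq> D1" "measure M E1 \<le> c * measure M D1"
      and g1r: "\<And>x. x \<notin> E1 \<Longrightarrow> g1 x = ?I D1 x" "\<And>x. r x = 0 \<Longrightarrow> g1 x = 0"
      and g1S: "\<And>N. L1 (S N g1) \<le> 2 * L1 (?I D1) + real n * (2 * e) + \<eta> / 4"
        "\<And>N. N \<ge> N0 \<Longrightarrow> L1 (S N g1) \<le> 2 * L1 (?I D1) + real n * (2 * e)"
      using Suc.IH[OF D1(1) D1\<tau>] by blast
    \<comment> \<open>Scales \<open>\<delta>\<close> so that the first \<open>N0\<close>
      coefficients of the new piece, weighted by the norms of the \<open>\<phi> j\<close>,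
      contribute at most \<open>e\<close>. The summand 1 beside the sum serves the extra function of
      index \<open>N0\<close> below.\<close>
    define P where "P = measure M (space M) * (1 + (\<Sum>j<N0. L1 (\<phi> j))) + 1"
    have sum0: "0 \<le> (\<Sum>j<N0. L1 (\<phi> j))" by (intro sum_nonneg) auto
    have P: "0 < P" using sum0 by (auto simp: P_def intro!: add_nonneg_pos mult_nonneg_nonneg)
    define \<delta> where "\<delta> = e / P"
    have \<delta>: "0 < \<delta>" using e P by (simp add: \<delta>_def)
    have \<delta>e: "\<delta> * measure M D2 * (1 + (\<Sum>j<N0. L1 (\<phi> j))) \<le> e"
    proof -
      have "\<delta> * (measure M D2 * (1 + (\<Sum>j<N0. L1 (\<phi> j)))) \<le> \<delta> * P"
        unfolding P_def using \<delta> sum0 bounded_measure[of D2]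
        by (intro mult_left_mono add_increasing2 mult_right_mono) auto
      then show ?thesis using P by (simp add: \<delta>_def mult.assoc)
    qed
    obtain K where K: "\<And>n x. r x \<noteq> 0 \<Longrightarrow> norm (\<psi> n x) \<le> K n" using r\<psi> by metis
    \<comment> \<open>Besides the products that govern the first \<open>N0\<close> coefficients, the
      list contains the norm of \<open>r\<close>. So \<open>E2\<close> also receives nearly the
      proportion \<open>c\<close> of the L1-mass of \<open>r\<close> on \<open>D2\<close>, which is
      why \<open>h\<close> costs about twice that mass. The products are bounded because each
      \<open>\<psi> j\<close> is bounded where \<open>r\<close> is nonzero.\<close>
    define u where "u j x = (if j < N0 then r x * \<psi> j x else of_real (norm (r x)))" for j x
    have um: "u j \<in> borel_measurable M" for j
      using r borel_measurable_integrable[OF integrable_\<psi>[of j]] by (auto simp: u_def[abs_def])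
    define B' where "B' = B + (\<Sum>j<N0. B * \<bar>K j\<bar>)"
    have ub: "norm (u j x) \<le> B'" for j x
    proof (cases "j < N0")
      case True
      have "norm (r x) * norm (\<psi> j x) \<le> B * \<bar>K j\<bar>"
      proof (cases "r x = 0")
        case False
        then have "norm (\<psi> j x) \<le> \<bar>K j\<bar>" using K[of x j] by linarith
        then show ?thesis using r(2)[of x] B by (intro mult_mono) auto
      qed (use B in auto)
      also have "\<dots> \<le> (\<Sum>j<N0. B * \<bar>K j\<bar>)" using True B by (intro member_le_sum) auto
      finally show ?thesis using B True by (simp add: u_def B'_def norm_mult)
    next
      case False
      then show ?thesis using B r(2)[of x] by (auto simp: u_def B'_def intro!: add_increasing2 sum_nonneg)
    qed
    obtain E2 where E2: "E2 \<in> sets M" "E2 \<subseteq> D2" "measure M E2 = c * measure M D2"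
      and E2u: "\<And>j. j < Suc N0 \<Longrightarrow> norm ((LINT x|M. indicator D2 x *\<^sub>R u j x) - (1 / c) *\<^sub>R (LINT x|M. indicator E2 x *\<^sub>R u j x))
         \<le> \<delta> * measure M D2"
      using proportional_subset[where u=u and N="Suc N0", OF um ub c \<delta> D2(1)] by blast
    define h where "h x = ?I D2 x - (1 / c) *\<^sub>R ?I E2 x" for x
    have hm: "h \<in> borel_measurable M" unfolding h_def using r D2 E2 by auto
    have hC: "norm (h x) \<le> C * indicator D2 x" for x
    proof (cases "x \<in> D2")
      case True
      have "norm (h x) \<le> norm (?I D2 x) + norm ((1 / c) *\<^sub>R ?I E2 x)" unfolding h_def by (rule norm_triangle_ineq4)
      also have "\<dots> \<le> B + (1 / c) * B"
        using r(2)[of x] c B by (intro add_mono) (auto split: split_indicator simp: divide_right_mono)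
      also have "\<dots> = B * (1 + 1 / c)" by (simp add: distrib_left)
      also have "\<dots> \<le> C" unfolding C_def using c by (intro mult_right_mono) auto
      finally show ?thesis using True by simp
    qed (use E2 in \<open>auto simp: h_def split: split_indicator\<close>)
    have hC': "norm (h x) \<le> C" for x using hC[of x] C by (auto split: split_indicator_asm)
    have coeff: "norm (LINT x|M. h x * \<psi> j x) \<le> \<delta> * measure M D2" if "j < N0" for j
    proof -
      have i: "integrable M (\<lambda>x. indicator A x *\<^sub>R u j x)" if "A \<in> sets M" for A
        using that um ub by (rule integrable_indicator_bounded)
      have "(LINT x|M. h x * \<psi> j x) = (LINT x|M. indicator D2 x *\<^sub>R u j x - (1 / c) *\<^sub>R (indicator E2 x *\<^sub>R u j x))"
        using that by (simp add: h_def u_def left_diff_distrib)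
      also have "\<dots> = (LINT x|M. indicator D2 x *\<^sub>R u j x) - (1 / c) *\<^sub>R (LINT x|M. indicator E2 x *\<^sub>R u j x)"
        using i[OF D2(1)] i[OF E2(1)] by (simp only: Bochner_Integration.integral_diff integrable_scaleR_right integral_scaleR_right)
      finally show ?thesis using E2u[of j] that by simp
    qed
    have early: "L1 (S N h) \<le> e" if "N \<le> N0" for N
    proof -
      have "L1 (S N h) \<le> (\<Sum>j<N. norm (LINT x|M. h x * \<psi> j x) * L1 (\<phi> j))" by (rule L1_S_le)
      also have "\<dots> \<le> (\<Sum>j<N. \<delta> * measure M D2 * L1 (\<phi> j))"
        using coeff that by (intro sum_mono mult_right_mono) auto
      also have "\<dots> \<le> (\<Sum>j<N0. \<delta> * measure M D2 * L1 (\<phi> j))"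
        using that \<delta> by (intro sum_mono2) auto
      also have "\<dots> = \<delta> * measure M D2 * (\<Sum>j<N0. L1 (\<phi> j))" by (simp add: sum_distrib_left)
      also have "\<dots> \<le> \<delta> * measure M D2 * (1 + (\<Sum>j<N0. L1 (\<phi> j)))"
        using \<delta> by (intro mult_left_mono) auto
      finally show ?thesis using \<delta>e by simp
    qed
    have mid: "L1 (S N h) \<le> \<eta> / 4" for N
      using \<tau>(2)[OF hm D2(1) D2\<tau> hC] .
    have L1h: "L1 h \<le> 2 * L1 (?I D2) + e"
    proof -
      have o: "(LINT x|M. indicator A x *\<^sub>R u N0 x) = of_real (L1 (?I A))" if "A \<in> sets M" for A
      proof -
        have "(LINT x|M. indicator A x *\<^sub>R u N0 x) = (LINT x|M. (norm (?I A x)) *\<^sub>R 1)"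
          by (intro Bochner_Integration.integral_cong) (auto simp: u_def of_real_def)
        also have "\<dots> = of_real (L1 (?I A))"
          using integrable_norm[OF intI[OF that]] by (subst integral_scaleR_left) (auto simp: of_real_def)
        finally show ?thesis .
      qed
      have "\<bar>L1 (?I D2) - (1 / c) * L1 (?I E2)\<bar>
          = norm (of_real (L1 (?I D2) - (1 / c) * L1 (?I E2)) :: 'a)" by (simp only: norm_of_real)
      also have "\<dots> = norm ((LINT x|M. indicator D2 x *\<^sub>R u N0 x) - (1 / c) *\<^sub>R (LINT x|M. indicator E2 x *\<^sub>R u N0 x))"
        unfolding o[OF D2(1)] o[OF E2(1)] by (simp add: scaleR_conv_of_real)
      also have "\<dots> \<le> \<delta> * measure M D2" using E2u[of N0] by simp
      also have "\<dots> \<le> \<delta> * measure M D2 * (1 + (\<Sum>j<N0. L1 (\<phi> j)))"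
        using \<delta> sum0 mult_left_mono[of 1 "1 + (\<Sum>j<N0. L1 (\<phi> j))" "\<delta> * measure M D2"] by simp
      also have "\<dots> \<le> e" by (rule \<delta>e)
      finally have "(1 / c) * L1 (?I E2) \<le> L1 (?I D2) + e" by linarith
      moreover have "L1 h \<le> L1 (?I D2) + L1 (\<lambda>x. (1 / c) *\<^sub>R ?I E2 x)"
        unfolding h_def using intI[OF D2(1)] intI[OF E2(1)] by (intro L1_triangle_diff integrable_scaleR_right)
      moreover have "L1 (\<lambda>x. (1 / c) *\<^sub>R ?I E2 x) = (1 / c) * L1 (?I E2)" using c by simp
      ultimately show ?thesis by linarith
    qed
    have hi: "integrable M h" using integrable_bounded[OF hm hC'] .
    have "eventually (\<lambda>N. L1 (\<lambda>x. S N h x - h x) < e) sequentially"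
      using order_tendstoD(2)[OF converges[OF hm hC'] e] .
    then obtain N1 where N1: "\<And>N. N \<ge> N1 \<Longrightarrow> L1 (\<lambda>x. S N h x - h x) < e"
      unfolding eventually_sequentially by blast
    have late: "L1 (S N h) \<le> 2 * L1 (?I D2) + 2 * e" if "N \<ge> N1" for N
      using L1_triangle[of "\<lambda>x. S N h x - h x" h] hi N1[OF that] L1h by simp
    have SN: "L1 (S N (\<lambda>x. g1 x + h x)) \<le> L1 (S N g1) + L1 (S N h)" for N
      unfolding S_add[OF integrable_bounded_mult[OF g1] integrable_bounded_mult[OF hm hC']]
      by (intro L1_triangle) auto
    have Isplit: "L1 (?I D) = L1 (?I D1) + L1 (?I D2)"
    proof -
      have "L1 (?I D) = (LINT x|M. norm (?I D1 x) + norm (?I D2 x))"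
        using D1 by (intro Bochner_Integration.integral_cong) (auto simp: D2_def split: split_indicator)
      also have "\<dots> = L1 (?I D1) + L1 (?I D2)"
        by (intro Bochner_Integration.integral_add integrable_norm intI D1(1) D2(1))
      finally show ?thesis .
    qed
    have I0: "0 \<le> L1 (?I D2)" by simp
    have Sn: "real (Suc n) * (2 * e) = real n * (2 * e) + 2 * e" by (simp add: algebra_simps)
    \<comment> \<open>Three ranges of \<open>N\<close>: up to \<open>N0\<close> the new piece is
      negligible while an older one may be in transition; from \<open>N0\<close> on the older ones
      have settled while the new one may be in transition; beyond both \<open>N0\<close> and
      \<open>N1\<close> all have settled.\<close>
    have ar1: "x \<le> 2 * (a + b) + (k + 2 * e) + t"
      if "x \<le> s + q" "s \<le> 2 * a + k + t" "q \<le> e" "0 < e" "0 \<le> b" for x a b k t s q :: real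
      using that by argo
    have ar2: "x \<le> 2 * (a + b) + (k + 2 * e) + t"
      if "x \<le> s + q" "s \<le> 2 * a + k" "q \<le> t" "0 < e" "0 \<le> b" for x a b k t s q :: real
      using that by argo
    have ar3: "x \<le> 2 * (a + b) + (k + 2 * e)"
      if "x \<le> s + q" "s \<le> 2 * a + k" "q \<le> 2 * b + 2 * e" for x a b k s q :: real
      using that by argo
    have all: "L1 (S N (\<lambda>x. g1 x + h x)) \<le> 2 * L1 (?I D) + real (Suc n) * (2 * e) + \<eta> / 4" for N
    proof (cases "N \<le> N0")
      case True
      show ?thesis unfolding Isplit Sn by (rule ar1[OF SN g1S(1) early[OF True] e I0])
    next
      case False
      then have "N0 \<le> N" by simp
      show ?thesis unfolding Isplit Sn by (rule ar2[OF SN g1S(2)[OF \<open>N0 \<le> N\<close>] mid e I0])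
    qed
    have large: "L1 (S N (\<lambda>x. g1 x + h x)) \<le> 2 * L1 (?I D) + real (Suc n) * (2 * e)" if "N0 \<le> N" "N1 \<le> N" for N
      unfolding Isplit Sn by (rule ar3[OF SN g1S(2)[OF that(1)] late[OF that(2)]])
    have supp: "x \<notin> D1 \<Longrightarrow> g1 x = 0" "x \<notin> D2 \<Longrightarrow> h x = 0" for x
      using E1(2) E2(2) g1r(1)[of x] by (auto simp: h_def split: split_indicator)
    have "norm (g1 x + h x) \<le> C" for x
    proof (cases "x \<in> D1")
      case True
      then have "x \<notin> D2" using D2(3) by auto
      then show ?thesis using supp(2) g1(2) by simp
    qed (use supp(1) hC' in simp)
    moreover have "measure M (E1 \<union> E2) \<le> c * measure M D"
    proof -
      have "measure M (E1 \<union> E2) \<le> measure M E1 + measure M E2" using E1 E2 by (intro measure_Un_le)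
      also have "\<dots> \<le> c * measure M D1 + c * measure M D2" using E1 E2 by simp
      also have "\<dots> = c * measure M D" by (simp add: mD algebra_simps)
      finally show ?thesis .
    qed
    moreover have "g1 x + h x = ?I D x" if "x \<notin> E1 \<union> E2" for x
      using that g1r(1)[of x] D1(2) by (auto simp: h_def D2_def split: split_indicator)
    moreover have "g1 x + h x = 0" if "r x = 0" for x using that g1r(2) by (simp add: h_def)
    ultimately show ?case using all large g1(1) hm E1 E2 D1(2) D2(2)
      by (intro exI[of _ "\<lambda>x. g1 x + h x"] exI[of _ "E1 \<union> E2"] exI[of _ "max N0 N1"] conjI allI impI) auto
  qed
  have "measure M (space M) \<le> real m * \<tau>" using m \<tau>(1) by (simp add: divide_le_eq)
  from block[OF sets.top this] obtain g E where g: "g \<in> borel_measurable M" "\<And>x. norm (g x) \<le> C"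
      and E: "E \<in> sets M" "measure M E \<le> c * measure M (space M)"
      and gr: "\<And>x. x \<notin> E \<Longrightarrow> g x = ?I (space M) x" "\<And>x. r x = 0 \<Longrightarrow> g x = 0"
      and gS: "\<And>N. L1 (S N g) \<le> 2 * L1 (?I (space M)) + real m * (2 * e) + \<eta> / 4"
    by blast
  have "L1 (?I (space M)) = \<eta>" unfolding \<eta>_def by (intro Bochner_Integration.integral_cong) auto
  with gS me \<eta> have "L1 (S N g) \<le> 3 * \<eta>" for N using order_trans[OF gS[of N], of "3 * \<eta>"] by linarith
  then show ?thesis using g E gr unfolding \<eta>_def by (intro exI[of _ g] exI[of _ E]) auto
qed

end

section \<open>Sums of corrected functions\<close>

context finite_measure begin

text \<open>By monotone convergence the sum of the norms has a finite integral, so it is finite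
  almost everywhere and dominates the series. On the remaining null set the value of the infinite
  sum is irrelevant.\<close>

lemma summable_integral_norm:
  fixes f :: "nat \<Rightarrow> 'a \<Rightarrow> 'b::{banach, second_countable_topology}"
  assumes f: "\<And>j. integrable M (f j)" and le: "\<And>j. (LINT x|M. norm (f j x)) \<le> a j" and a: "summable a"
  shows AE_summable_norm: "AE x in M. summable (\<lambda>j. norm (f j x))"
    and integrable_suminf_norm: "integrable M (\<lambda>x. \<Sum>j. f j x)"
    and integral_norm_suminf_le: "(LINT x|M. norm (\<Sum>j. f j x)) \<le> suminf a"
proof -
  have sm: "summable (\<lambda>j. LINT x|M. norm (f j x))"
    using le by (intro summable_comparison_test'[OF a]) auto
  have "(\<integral>\<^sup>+ x. (\<Sum>j. ennreal (norm (f j x))) \<partial>M) = (\<Sum>j. \<integral>\<^sup>+ x. ennreal (norm (f j x)) \<partial>M)"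
    using f by (intro nn_integral_suminf) auto
  also have "\<dots> = (\<Sum>j. ennreal (LINT x|M. norm (f j x)))"
    using f by (simp add: nn_integral_eq_integral)
  also have "\<dots> = ennreal (\<Sum>j. LINT x|M. norm (f j x))"
    using sm by (intro suminf_ennreal2) auto
  finally have "AE x in M. (\<Sum>j. ennreal (norm (f j x))) \<noteq> \<infinity>"
    using f by (intro nn_integral_PInf_AE) auto
  then show ae: "AE x in M. summable (\<lambda>j. norm (f j x))"
    by eventually_elim (auto intro: summable_suminf_not_top)
  show int: "integrable M (\<lambda>x. \<Sum>j. f j x)" by (rule integrable_suminf[OF f ae sm])
  have "(LINT x|M. norm (\<Sum>j. f j x)) \<le> (LINT x|M. (\<Sum>j. norm (f j x)))"
  proof (rule integral_mono_AE)
    show "integrable M (\<lambda>x. \<Sum>j. norm (f j x))"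
      using f ae sm by (intro integrable_suminf) auto
    show "AE x in M. norm (\<Sum>j. f j x) \<le> (\<Sum>j. norm (f j x))"
      using ae by eventually_elim (rule summable_norm)
  qed (use int in auto)
  also have "\<dots> = (\<Sum>j. LINT x|M. norm (f j x))"
    using f ae sm by (intro integral_suminf) auto
  also have "\<dots> \<le> suminf a" using le by (intro suminf_le sm a)
  finally show "(LINT x|M. norm (\<Sum>j. f j x)) \<le> suminf a" .
qed

end

section \<open>Expansions of L1-absolutely convergent series\<close>

context L1_expansion begin

lemma S_cong_AE:
  assumes "h \<in> borel_measurable M" "k \<in> borel_measurable M" "AE x in M. h x = k x"
  shows "S N h = S N k"
proof -
  have "(LINT x|M. h x * \<psi> n x) = (LINT x|M. k x * \<psi> n x)" for n
    using assms borel_measurable_integrable[OF integrable_\<psi>[of n]] by (intro integral_cong_AE) auto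
  then show ?thesis by (simp add: partial_sum_def fun_eq_iff)
qed

text \<open>The uniform bound survives the passage to the L1-limit of the partial sums. Hence
  control of the partial sums of corrected functions already makes their series absolutely
  convergent in L1.\<close>

lemma L1_le_of_S_le:
  assumes g: "g \<in> borel_measurable M" "\<And>x. norm (g x) \<le> C" and a: "\<And>N. L1 (S N g) \<le> a"
  shows "L1 g \<le> a"
proof -
  have "L1 g \<le> L1 (\<lambda>x. S N g x - g x) + a" for N
    using L1_triangle_diff[of "S N g" "\<lambda>x. S N g x - g x"] integrable_bounded[OF g] a[of N] by simp
  moreover have "(\<lambda>N. L1 (\<lambda>x. S N g x - g x) + a) \<longlonglongrightarrow> 0 + a"
    by (intro tendsto_intros converges[OF g])
  ultimately have "L1 g \<le> 0 + a" by (intro LIMSEQ_le_const) auto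
  then show ?thesis by simp
qed

text \<open>All \<open>g j\<close> live on \<open>F\<close>, where \<open>\<psi> n\<close> is
  bounded, so multiplication by \<open>\<psi> n\<close> preserves absolute convergence in L1.
  Coefficients, and with them \<open>S N\<close>, may then be taken term by term.\<close>

lemma suminf_expansion:
  assumes g: "\<And>j. g j \<in> borel_measurable M" "\<And>j. \<exists>C. \<forall>x. norm (g j x) \<le> C"
    and a: "\<And>j N. L1 (S N (g j)) \<le> a j" "summable a"
    and F: "\<And>j x. x \<notin> F \<Longrightarrow> g j x = 0" "\<And>n x. x \<in> F \<Longrightarrow> norm (\<psi> n x) \<le> K n"
  shows integrable_suminf_mult: "integrable M (\<lambda>x. (\<Sum>j. g j x) * \<psi> n x)"
    and L1_S_suminf_le: "L1 (S N (\<lambda>x. \<Sum>j. g j x)) \<le> suminf a"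
proof -
  obtain C where C: "\<And>j x. norm (g j x) \<le> C j" using g(2) by metis
  have gi: "integrable M (g j)" for j using integrable_bounded[OF g(1) C] .
  have ga: "L1 (g j) \<le> a j" for j using L1_le_of_S_le[OF g(1) C a(1)] .
  note ae = AE_summable_norm[OF gi ga a(2)]
  have g\<psi>: "integrable M (\<lambda>x. g j x * \<psi> n x)" for j n by (rule integrable_bounded_mult[OF g(1) C])
  have le: "L1 (\<lambda>x. g j x * \<psi> n x) \<le> a j * \<bar>K n\<bar>" for j n
  proof -
    have "norm (g j x * \<psi> n x) \<le> norm (g j x) * \<bar>K n\<bar>" for x
    proof (cases "x \<in> F")
      case True
      then have "norm (\<psi> n x) \<le> \<bar>K n\<bar>" using F(2)[of x n] by linarith
      then show ?thesis by (simp add: norm_mult mult_left_mono)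
    qed (simp add: F)
    then have "L1 (\<lambda>x. g j x * \<psi> n x) \<le> (LINT x|M. norm (g j x) * \<bar>K n\<bar>)"
      using g\<psi> gi by (intro integral_mono) auto
    also have "\<dots> = L1 (g j) * \<bar>K n\<bar>" using gi by simp
    also have "\<dots> \<le> a j * \<bar>K n\<bar>" using ga by (intro mult_right_mono) auto
    finally show ?thesis .
  qed
  have aK: "summable (\<lambda>j. a j * \<bar>K n\<bar>)" for n using a(2) by (rule summable_mult2)
  have eq: "AE x in M. (\<Sum>j. g j x * \<psi> n x) = (\<Sum>j. g j x) * \<psi> n x" for n
    using ae by eventually_elim (auto intro!: suminf_mult2[symmetric] dest: summable_norm_cancel)
  have Gm: "(\<lambda>x. (\<Sum>j. g j x) * \<psi> n x) \<in> borel_measurable M" for n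
    using g(1) borel_measurable_integrable[OF integrable_\<psi>[of n]] by auto
  have int: "integrable M (\<lambda>x. \<Sum>j. g j x * \<psi> n x)" for n
    by (rule integrable_suminf_norm[OF g\<psi> le aK])
  show "integrable M (\<lambda>x. (\<Sum>j. g j x) * \<psi> n x)"
    using int[of n] integrable_cong_AE[OF borel_measurable_integrable[OF int] Gm eq] by simp
  have "(\<lambda>j. LINT x|M. g j x * \<psi> n x) sums (LINT x|M. (\<Sum>j. g j x * \<psi> n x))" for n
    using AE_summable_norm[OF g\<psi> le aK] le
    by (intro sums_integral g\<psi> summable_comparison_test'[OF aK]) auto
  then have "(\<lambda>j. LINT x|M. g j x * \<psi> n x) sums (LINT x|M. (\<Sum>j. g j x) * \<psi> n x)" for n
    using integral_cong_AE[OF borel_measurable_integrable[OF int] Gm eq] by simp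
  then have "(\<lambda>j. S N (g j) x) sums S N (\<lambda>x. \<Sum>j. g j x) x" for x
    unfolding partial_sum_def by (intro sums_sum sums_mult2)
  then have "S N (\<lambda>x. \<Sum>j. g j x) = (\<lambda>x. \<Sum>j. S N (g j) x)"
    by (auto simp: fun_eq_iff sums_iff)
  then show "L1 (S N (\<lambda>x. \<Sum>j. g j x)) \<le> suminf a"
    using integral_norm_suminf_le[OF integrable_S a] by simp
qed

text \<open>A head \<open>H\<close> of the series is bounded, so its expansion converges. The tail
  \<open>R\<close> and all its partial sums are bounded in L1 by the tail of
  \<open>suminf a\<close>, uniformly in \<open>N\<close>.\<close>

lemma suminf_converges:
  assumes g: "\<And>j. g j \<in> borel_measurable M" "\<And>j. \<exists>C. \<forall>x. norm (g j x) \<le> C"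
    and a: "\<And>j N. L1 (S N (g j)) \<le> a j" "summable a"
    and F: "\<And>j x. x \<notin> F \<Longrightarrow> g j x = 0" "\<And>n x. x \<in> F \<Longrightarrow> norm (\<psi> n x) \<le> K n"
  shows "(\<lambda>N. L1 (\<lambda>x. S N (\<lambda>x. \<Sum>j. g j x) x - (\<Sum>j. g j x))) \<longlonglongrightarrow> 0"
proof (rule LIMSEQ_I)
  fix e :: real assume e: "0 < e"
  obtain C where C: "\<And>j x. norm (g j x) \<le> C j" using g(2) by metis
  have gi: "integrable M (g j)" for j using integrable_bounded[OF g(1) C] .
  have ga: "L1 (g j) \<le> a j" for j using L1_le_of_S_le[OF g(1) C a(1)] .
  note ae = AE_summable_norm[OF gi ga a(2)]
  define G where "G x = (\<Sum>j. g j x)" for x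
  have Gi: "integrable M G" unfolding G_def by (rule integrable_suminf_norm[OF gi ga a(2)])
  have G\<psi>: "integrable M (\<lambda>x. G x * \<psi> n x)" for n
    unfolding G_def by (rule integrable_suminf_mult[OF g a F])
  obtain J where J: "(\<Sum>j. a (j + J)) < e / 3"
  proof -
    have "(\<lambda>J. \<Sum>j. a (j + J)) \<longlonglongrightarrow> 0" using suminf_exist_split2[OF a(2)] .
    from eventually_happens[OF order_tendstoD(2)[OF this, of "e / 3"]] e show ?thesis using that by auto
  qed
  define H where "H x = (\<Sum>j<J. g j x)" for x
  define R where "R x = (\<Sum>j. g (j + J) x)" for x
  have aJ: "summable (\<lambda>j. a (j + J))" using a(2) by simp
  have Hm: "H \<in> borel_measurable M" unfolding H_def using g(1) by auto
  have HC: "norm (H x) \<le> (\<Sum>j<J. C j)" for x unfolding H_def by (intro sum_norm_le C)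
  have Hi: "integrable M H" using integrable_bounded[OF Hm HC] .
  have H\<psi>: "integrable M (\<lambda>x. H x * \<psi> n x)" for n by (rule integrable_bounded_mult[OF Hm HC])
  have Ri: "integrable M R" and RL: "L1 R \<le> (\<Sum>j. a (j + J))"
    unfolding R_def using integrable_suminf_norm[OF gi ga aJ] integral_norm_suminf_le[OF gi ga aJ] by auto
  have SR: "L1 (S N R) \<le> (\<Sum>j. a (j + J))" for N
    unfolding R_def by (rule L1_S_suminf_le[where g="\<lambda>j. g (j + J)" and a="\<lambda>j. a (j + J)", OF g a(1) aJ F])
  have R\<psi>: "integrable M (\<lambda>x. R x * \<psi> n x)" for n
    unfolding R_def by (rule integrable_suminf_mult[where g="\<lambda>j. g (j + J)" and a="\<lambda>j. a (j + J)", OF g a(1) aJ F])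
  have GHR: "AE x in M. G x = H x + R x"
    using ae unfolding G_def H_def R_def
    by eventually_elim (simp add: suminf_split_initial_segment[OF summable_norm_cancel, of _ J] add.commute)
  have HRi: "integrable M (\<lambda>x. H x + R x)" using Hi Ri by simp
  have "S N G = S N (\<lambda>x. H x + R x)" for N
    using Gi HRi GHR by (intro S_cong_AE borel_measurable_integrable)
  then have SG: "S N G = (\<lambda>x. S N H x + S N R x)" for N
    using S_add[OF H\<psi> R\<psi>] by simp
  have bound: "L1 (\<lambda>x. S N G x - G x) \<le> L1 (\<lambda>x. S N H x - H x) + (L1 (S N R) + L1 R)" for N
  proof -
    have "L1 (\<lambda>x. S N G x - G x) = L1 (\<lambda>x. (S N H x - H x) + (S N R x - R x))"
    proof (rule integral_cong_AE)
      have "integrable M (\<lambda>x. S N G x - G x)" using Gi by auto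
      then show "(\<lambda>x. norm (S N G x - G x)) \<in> borel_measurable M" by auto
      have "integrable M (\<lambda>x. (S N H x - H x) + (S N R x - R x))" using Hi Ri by auto
      then show "(\<lambda>x. norm ((S N H x - H x) + (S N R x - R x))) \<in> borel_measurable M" by auto
      show "AE x in M. norm (S N G x - G x) = norm ((S N H x - H x) + (S N R x - R x))"
        using GHR by eventually_elim (simp add: SG algebra_simps)
    qed
    also have "\<dots> \<le> L1 (\<lambda>x. S N H x - H x) + L1 (\<lambda>x. S N R x - R x)"
      using Hi Ri by (intro L1_triangle) auto
    also have "L1 (\<lambda>x. S N R x - R x) \<le> L1 (S N R) + L1 R"
      using Ri by (intro L1_triangle_diff) auto
    finally show ?thesis by simp
  qed
  have "eventually (\<lambda>N. L1 (\<lambda>x. S N H x - H x) < e / 3) sequentially"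
    using order_tendstoD(2)[OF converges[OF Hm HC], of "e / 3"] e by simp
  then obtain N0 where N0: "\<And>N. N \<ge> N0 \<Longrightarrow> L1 (\<lambda>x. S N H x - H x) < e / 3"
    unfolding eventually_sequentially by blast
  have "L1 (\<lambda>x. S N G x - G x) < e" if "N \<ge> N0" for N
    using bound[of N] N0[OF that] SR[of N] RL J by linarith
  then show "\<exists>N0. \<forall>N\<ge>N0. norm (L1 (\<lambda>x. S N (\<lambda>x. \<Sum>j. g j x) x - (\<Sum>j. g j x)) - 0) < e"
    unfolding G_def by auto
qed

end

section \<open>Divisibility and separability for Lebesgue measure\<close>

lemma measure_unit_leb: "A \<subseteq> {0<..<1} \<Longrightarrow> measure unit_leb A = measure lebesgue A"
  by (simp add: measure_restrict_space)

lemma sets_unit_leb: "A \<in> sets unit_leb \<longleftrightarrow> A \<in> sets lebesgue \<and> A \<subseteq> {0<..<1}"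
  by (auto simp: sets_restrict_space_iff)

text \<open>The measure of the part of \<open>A\<close> to the left of \<open>t\<close> is
  1-Lipschitz in \<open>t\<close> and grows from 0 to the measure of \<open>A\<close>; the
  intermediate value theorem gives the cut.\<close>

lemma unit_leb_divisible:
  assumes A: "A \<in> sets unit_leb" and c: "0 \<le> c" "c \<le> 1"
  shows "\<exists>E\<in>sets unit_leb. E \<subseteq> A \<and> measure unit_leb E = c * measure unit_leb A"
proof -
  interpret finite_measure unit_leb by (rule finite_measure_unit_leb)
  have A': "A \<in> sets lebesgue" "A \<subseteq> {0<..<1}" using A by (auto simp: sets_unit_leb)
  define m where "m t = measure unit_leb (A \<inter> {..t})" for t
  have set: "A \<inter> {..t} \<in> sets unit_leb" for t using A' by (auto simp: sets_unit_leb)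
  have mono: "m s \<le> m t" if "s \<le> t" for s t
    unfolding m_def using that set by (intro finite_measure_mono) auto
  have lip: "m t - m s \<le> t - s" if "s \<le> t" for s t
  proof -
    have "m t - m s = measure unit_leb (A \<inter> {..t} - A \<inter> {..s})"
      unfolding m_def using that set by (intro finite_measure_Diff[symmetric]) auto
    also have "\<dots> = measure lebesgue (A \<inter> {..t} - A \<inter> {..s})" using A' by (intro measure_unit_leb) auto
    also have "\<dots> \<le> measure lebesgue {s..t}"
      using A' set[of s] set[of t] by (intro measure_mono_fmeasurable sets.Diff) (auto simp: sets_unit_leb)
    finally show ?thesis using that by simp
  qed
  have "continuous_on {0..1} m"
    unfolding continuous_on_iff
  proof (intro ballI allI impI)
    fix x e :: real assume "0 < e"
    moreover have "\<bar>m y - m x\<bar> \<le> \<bar>y - x\<bar>" for y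
      using mono[of x y] mono[of y x] lip[of x y] lip[of y x] by (cases "x \<le> y") auto
    ultimately show "\<exists>d>0. \<forall>y\<in>{0..1}. dist y x < d \<longrightarrow> dist (m y) (m x) < e"
      unfolding dist_real_def by (metis le_less_trans)
  qed
  moreover have "m 0 = 0"
  proof -
    have "A \<inter> {..0} = {}" using A' by auto
    then show ?thesis by (simp add: m_def)
  qed
  moreover have "m 1 = measure unit_leb A"
  proof -
    have "A \<inter> {..1} = A" using A' by auto
    then show ?thesis by (simp add: m_def)
  qed
  ultimately obtain t where "m t = c * measure unit_leb A"
    using IVT'[of m 0 "c * measure unit_leb A" 1] c by (auto simp: mult_left_le_one_le)
  then show ?thesis using set[of t] by (intro bexI[of _ "A \<inter> {..t}"]) (auto simp: m_def)
qed

text \<open>Coding by lists of coefficients and thresholds makes a countable family out of countable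
  data, and concatenation of codes becomes addition of functions.\<close>

definition step_fun :: "('a \<times> real) list \<Rightarrow> real \<Rightarrow> 'a::real_vector" where
  "step_fun l x = (\<Sum>(c, t)\<leftarrow>l. indicator {..t} x *\<^sub>R c)"

lemma step_fun_simps [simp]:
  "step_fun [] x = 0"
  "step_fun ((c, t) # l) x = indicator {..t} x *\<^sub>R c + step_fun l x"
  "step_fun (l @ l') x = step_fun l x + step_fun l' x"
  by (simp_all add: step_fun_def)

lemma step_fun_bounded: "\<exists>B. \<forall>x. norm (step_fun l x :: 'a::real_normed_vector) \<le> B"
proof (induction l)
  case (Cons p l)
  obtain c t where p: "p = (c, t)" by (cases p)
  obtain B where B: "\<And>x. norm (step_fun l x) \<le> B" using Cons by blast
  have "norm (indicator {..t} x *\<^sub>R c + step_fun l x) \<le> norm c + B" for x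
    using B[of x] by (intro norm_triangle_le add_mono) (auto split: split_indicator)
  then show ?case by (auto simp: p)
qed (auto intro: exI[of _ 0])

lemma step_fun_measurable: "(step_fun l :: real \<Rightarrow> 'a::euclidean_space) \<in> borel_measurable unit_leb"
proof -
  have "(step_fun l :: real \<Rightarrow> 'a) \<in> borel_measurable borel"
  proof (induction l)
    case Nil then show ?case by (simp cong: measurable_cong)
  next
    case (Cons p l)
    have "step_fun (p # l) = (\<lambda>x. indicator {..snd p} x *\<^sub>R fst p + step_fun l x)"
      by (cases p) (simp add: fun_eq_iff)
    then show ?case using Cons by simp
  qed
  then have "step_fun l \<in> borel_measurable lebesgue" by (simp add: measurable_completion)
  then show ?thesis by (rule measurable_restrict_space1)
qed

text \<open>The class \<open>cl\<close> of approximable functions is closed under sums and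
  L1-limits. It contains multiples of indicators of rays, hence of Borel sets by a Dynkin argument,
  of Lebesgue sets up to null sets, and finally all integrable functions.\<close>

lemma L1_separable:
  fixes f :: "real \<Rightarrow> 'a::euclidean_space"
  assumes Q: "\<And>X. open X \<Longrightarrow> X \<noteq> {} \<Longrightarrow> \<exists>q\<in>Q. q \<in> (X :: 'a set)"
    and f: "integrable unit_leb f" and e: "0 < e"
  shows "\<exists>l\<in>lists (Q \<times> \<rat>). (LINT x|unit_leb. norm (f x - step_fun l x)) < e"
proof -
  let ?M = unit_leb
  interpret finite_measure unit_leb by (rule finite_measure_unit_leb)
  have si: "integrable ?M (step_fun l :: real \<Rightarrow> 'a)" for l
    using step_fun_bounded[of l] step_fun_measurable[of l] by (auto intro: integrable_const_bound)
  define cl where "cl f \<longleftrightarrow> integrable ?M f \<and> (\<forall>e>0. \<exists>l\<in>lists (Q \<times> \<rat>). (LINT x|?M. norm (f x - step_fun l x)) < e)"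
    for f :: "real \<Rightarrow> 'a"
  have tri: "(LINT x|?M. norm (f x + g x)) \<le> (LINT x|?M. norm (f x)) + (LINT x|?M. norm (g x))"
    if "integrable ?M f" "integrable ?M g" for f g :: "real \<Rightarrow> 'a"
  proof -
    have "(LINT x|?M. norm (f x + g x)) \<le> (LINT x|?M. norm (f x) + norm (g x))"
      using that by (intro integral_mono) (auto intro: norm_triangle_ineq)
    then show ?thesis using that by simp
  qed
  have cl_add: "cl (\<lambda>x. f x + g x)" if fg: "cl f" "cl g" for f g
    unfolding cl_def
  proof (intro conjI allI impI)
    fix e :: real assume "0 < e"
    then obtain l l' where l: "l \<in> lists (Q \<times> \<rat>)" "(LINT x|?M. norm (f x - step_fun l x)) < e / 2"
      and l': "l' \<in> lists (Q \<times> \<rat>)" "(LINT x|?M. norm (g x - step_fun l' x)) < e / 2"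
      using fg unfolding cl_def by (meson half_gt_zero)
    have "(LINT x|?M. norm ((f x + g x) - step_fun (l @ l') x))
       = (LINT x|?M. norm ((f x - step_fun l x) + (g x - step_fun l' x)))"
      by (simp add: algebra_simps)
    also have "\<dots> \<le> (LINT x|?M. norm (f x - step_fun l x)) + (LINT x|?M. norm (g x - step_fun l' x))"
      using fg si by (intro tri) (auto simp: cl_def)
    also have "\<dots> < e" using l l' by linarith
    finally show "\<exists>l\<in>lists (Q \<times> \<rat>). (LINT x|?M. norm ((f x + g x) - step_fun l x)) < e"
      using l l' by (intro bexI[of _ "l @ l'"]) auto
  qed (use fg in \<open>auto simp: cl_def\<close>)
  have cl_lim: "cl f" if f: "integrable ?M f" and s: "\<And>i. cl (s i)"
    and lim: "(\<lambda>i. LINT x|?M. norm (f x - s i x)) \<longlonglongrightarrow> 0" for f and s :: "nat \<Rightarrow> real \<Rightarrow> 'a"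
    unfolding cl_def
  proof (intro conjI allI impI f)
    fix e :: real assume "0 < e"
    then obtain i where i: "(LINT x|?M. norm (f x - s i x)) < e / 2"
      using eventually_happens[OF order_tendstoD(2)[OF lim, of "e / 2"]] by auto
    obtain l where l: "l \<in> lists (Q \<times> \<rat>)" "(LINT x|?M. norm (s i x - step_fun l x)) < e / 2"
      using s[of i] \<open>0 < e\<close> unfolding cl_def by (meson half_gt_zero)
    have "(LINT x|?M. norm (f x - step_fun l x)) = (LINT x|?M. norm ((f x - s i x) + (s i x - step_fun l x)))"
      by simp
    also have "\<dots> \<le> (LINT x|?M. norm (f x - s i x)) + (LINT x|?M. norm (s i x - step_fun l x))"
      using f s si by (intro tri) (auto simp: cl_def)
    also have "\<dots> < e" using l i by linarith
    finally show "\<exists>l\<in>lists (Q \<times> \<rat>). (LINT x|?M. norm (f x - step_fun l x)) < e" using l by blast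
  qed
  have cl_cong: "cl f" if "cl g" "integrable ?M f" "AE x in ?M. f x = g x" for f g
  proof (rule cl_lim[where s="\<lambda>_. g"])
    have "(LINT x|?M. norm (f x - g x)) = 0"
      using that by (intro integral_eq_zero_AE) (auto elim: eventually_mono)
    then show "(\<lambda>i::nat. LINT x|?M. norm (f x - g x)) \<longlonglongrightarrow> 0" by simp
  qed (use that in auto)
  have ind_i: "integrable ?M (\<lambda>x. indicator B x *\<^sub>R c)" if "B \<in> sets lebesgue" for B and c :: 'a
  proof (rule integrable_const_bound[where B="norm c"])
    have "(\<lambda>x. indicator B x *\<^sub>R c) \<in> borel_measurable lebesgue" using that by auto
    then show "(\<lambda>x. indicator B x *\<^sub>R c) \<in> borel_measurable ?M" by (rule measurable_restrict_space1)
  qed (auto split: split_indicator)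
  have ray: "cl (\<lambda>x. indicator {..t} x *\<^sub>R c)" for t and c :: 'a
    unfolding cl_def
  proof (intro conjI allI impI)
    fix e :: real assume e: "0 < e"
    obtain q where q: "q \<in> Q" "norm (c - q) < e / 2"
      using Q[of "ball c (e / 2)"] e by (auto simp: dist_norm)
    \<comment> \<open>Moving the threshold from \<open>t\<close> to a rational \<open>r\<close>
      closer than \<open>d\<close> costs at most \<open>norm q * d\<close>, which is at most e/2;
      the 1 handles \<open>q = 0\<close>.\<close>
    define d where "d = e / (2 * (norm q + 1))"
    have d: "0 < d" using e by (auto simp: d_def intro!: divide_pos_pos add_nonneg_pos)
    obtain r where r: "r \<in> \<rat>" "t < r" "r < t + d" using Rats_dense_in_real[of t "t + d"] d by auto
    have i: "integrable ?M (indicat_real {t<..r})"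
    proof (rule integrable_const_bound[where B=1])
      show "indicat_real {t<..r} \<in> borel_measurable ?M"
        by (intro measurable_restrict_space1 borel_measurable_indicator) auto
    qed (auto split: split_indicator)
    have "(LINT x|?M. norm (indicator {..t} x *\<^sub>R c - indicator {..r} x *\<^sub>R q))
      \<le> (LINT x|?M. norm (c - q) + norm q * indicator {t<..r} x)"
    proof (rule integral_mono)
      show "integrable ?M (\<lambda>x. norm (indicator {..t} x *\<^sub>R c - indicator {..r} x *\<^sub>R q))"
        using ind_i by (intro integrable_norm Bochner_Integration.integrable_diff) auto
      show "integrable ?M (\<lambda>x. norm (c - q) + norm q * indicator {t<..r} x)" using i by simp
      show "norm (indicator {..t} x *\<^sub>R c - indicator {..r} x *\<^sub>R q) \<le> norm (c - q) + norm q * indicator {t<..r} x" for x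
        using r by (auto split: split_indicator)
    qed
    also have "\<dots> = norm (c - q) * measure ?M {0<..<1} + norm q * measure ?M ({t<..r} \<inter> {0<..<1})"
    proof -
      have "(LINT x|?M. indicator {t<..r} x) = measure ?M ({t<..r} \<inter> {0<..<1})" by simp
      then show ?thesis using i by (simp add: mult.commute)
    qed
    also have "\<dots> \<le> norm (c - q) + norm q * d"
    proof -
      have "measure ?M ({t<..r} \<inter> {0<..<1}) = measure lebesgue ({t<..r} \<inter> {0<..<1})"
        by (rule measure_unit_leb) auto
      also have "\<dots> \<le> measure lebesgue {t..r}" by (intro measure_mono_fmeasurable) auto
      also have "\<dots> \<le> d" using r by simp
      finally have "measure ?M ({t<..r} \<inter> {0<..<1}) \<le> d" .
      moreover have "measure ?M {0<..<1} = 1" by (subst measure_unit_leb) auto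
      ultimately show ?thesis by (simp add: mult_left_mono)
    qed
    also have "\<dots> < e"
    proof -
      have "norm q * d \<le> (norm q + 1) * d" using d by (intro mult_right_mono) auto
      also have "\<dots> = e / 2" using norm_ge_zero[of q] by (simp add: d_def divide_simps add_nonneg_eq_0_iff)
      finally show ?thesis using q by linarith
    qed
    finally show "\<exists>l\<in>lists (Q \<times> \<rat>). (LINT x|?M. norm (indicator {..t} x *\<^sub>R c - step_fun l x)) < e"
      using q r by (intro bexI[of _ "[(q, r)]"]) auto
  qed (use ind_i in auto)
  have cl0: "cl (\<lambda>x. 0)" using si unfolding cl_def by (auto intro!: bexI[of _ "[]"])
  have borel_cl: "\<forall>c. cl (\<lambda>x. indicator B x *\<^sub>R c)" if "B \<in> sets borel" for B
  proof -
    have "Int_stable (range (atMost :: real \<Rightarrow> real set))" by (auto simp: Int_stable_def)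
    moreover have "range (atMost :: real \<Rightarrow> real set) \<subseteq> Pow UNIV" by auto
    moreover have "B \<in> sigma_sets UNIV (range atMost)" using that by (simp add: borel_eq_atMost)
    ultimately show ?thesis
    proof (induction B rule: sigma_sets_induct_disjoint)
      case (basic A)
      then show ?case using ray by auto
    next
      case empty
      then show ?case using cl0 by simp
    next
      case (compl A)
      show ?case
      proof
        fix c :: 'a
        have A: "A \<in> sets borel" using compl by (simp add: borel_eq_atMost)
        \<comment> \<open>On the unit interval the ray up to 1 is the whole space, so subtracting
          the indicator of \<open>A\<close> yields that of the complement.\<close>
        have "cl (\<lambda>x. indicator {..1} x *\<^sub>R c + indicator A x *\<^sub>R (- c))"
          using compl ray by (intro cl_add) blast+
        then show "cl (\<lambda>x. indicator (UNIV - A) x *\<^sub>R c)"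
        proof (rule cl_cong)
          show "integrable ?M (\<lambda>x. indicator (UNIV - A) x *\<^sub>R c)" using A by (intro ind_i) auto
        qed (auto intro!: AE_I2 split: split_indicator)
      qed
    next
      case (union A)
      show ?case
      proof
        fix c :: 'a
        have A: "A i \<in> sets borel" for i using union by (auto simp: borel_eq_atMost)
        define s where "s n x = (\<Sum>i<n. indicator (A i) x *\<^sub>R c)" for n x
        have cs: "cl (s n)" for n
        proof (induction n)
          case 0
          have "s 0 = (\<lambda>x. 0)" by (simp add: s_def fun_eq_iff)
          then show ?case using cl0 by simp
        next
          case (Suc n)
          have "s (Suc n) = (\<lambda>x. s n x + indicator (A n) x *\<^sub>R c)"
            unfolding s_def by (simp only: sum.lessThan_Suc)
          then show ?case using cl_add[OF Suc] union by simp
        qed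
        \<comment> \<open>Disjointness turns the finite sum into a single indicator, whence the
          bound \<open>norm c\<close> needed for dominated convergence.\<close>
        have s_eq: "s n x = indicator (\<Union>i<n. A i) x *\<^sub>R c" for n x
          unfolding s_def scaleR_left.sum[symmetric]
          by (subst indicator_UN_disjoint) (use union in \<open>auto simp: disjoint_family_on_def\<close>)
        show "cl (\<lambda>x. indicator (\<Union>i. A i) x *\<^sub>R c)"
        proof (rule cl_lim[where s=s])
          show int: "integrable ?M (\<lambda>x. indicator (\<Union>i. A i) x *\<^sub>R c)" using A by (intro ind_i) auto
          have "(\<lambda>n. LINT x|?M. norm (indicator (\<Union>i. A i) x *\<^sub>R c - s n x)) \<longlonglongrightarrow> (LINT x|?M. 0)"
          proof (rule integral_dominated_convergence[where w="\<lambda>x. norm c"])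
            show "(\<lambda>x. norm (indicator (\<Union>i. A i) x *\<^sub>R c - s n x)) \<in> borel_measurable ?M" for n
              using int cs[of n] by (auto simp: cl_def)
            show "AE x in ?M. (\<lambda>n. norm (indicator (\<Union>i. A i) x *\<^sub>R c - s n x)) \<longlonglongrightarrow> 0"
            proof (intro AE_I2)
              fix x
              have "eventually (\<lambda>n. indicator (\<Union>i. A i) x *\<^sub>R c = s n x) sequentially"
              proof (cases "x \<in> (\<Union>i. A i)")
                case True
                then obtain i where "x \<in> A i" by auto
                then show ?thesis by (intro eventually_sequentiallyI[of "Suc i"]) (auto simp: s_eq split: split_indicator)
              qed (auto simp: s_eq split: split_indicator)
              then show "(\<lambda>n. norm (indicator (\<Union>i. A i) x *\<^sub>R c - s n x)) \<longlonglongrightarrow> 0"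
                by (intro tendsto_eventually) (auto elim: eventually_mono)
            qed
          qed (auto simp: s_eq split: split_indicator)
          then show "(\<lambda>n. LINT x|?M. norm (indicator (\<Union>i. A i) x *\<^sub>R c - s n x)) \<longlonglongrightarrow> 0" by simp
        qed (rule cs)
      qed
    qed
  qed
  have "cl f"
    using f
  proof (induction rule: integrable_induct)
    case (base A c)
    then have A: "A \<in> sets lebesgue" by (auto simp: sets_unit_leb)
    obtain B where B: "A \<subseteq> B" "B \<in> sets borel" "B - A \<in> null_sets lebesgue"
      using completion_upper[of A lborel] A by auto
    have "cl (\<lambda>x. indicator B x *\<^sub>R c)" using borel_cl[OF B(2)] by blast
    then show ?case
    proof (rule cl_cong)
      have "AE x in lebesgue. x \<notin> B - A" using B(3) by (rule AE_not_in)
      then have "AE x in ?M. x \<notin> B - A" by (simp add: AE_restrict_space_iff eventually_mono)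
      then show "AE x in ?M. indicator A x *\<^sub>R c = indicator B x *\<^sub>R c"
        using B(1) by (auto elim!: eventually_mono split: split_indicator)
    qed (use ind_i[OF A] in auto)
  next
    case (add f g)
    then show ?case by (intro cl_add)
  next
    case (lim f s)
    show ?case
    proof (rule cl_lim[where s=s])
      have "(\<lambda>i. LINT x|?M. norm (f x - s i x)) \<longlonglongrightarrow> (LINT x|?M. 0)"
      \<comment> \<open>The approximants in \<open>integrable_induct\<close> satisfy
        \<open>norm (s i x) \<le> 2 * norm (f x)\<close>, hence the factor 3.\<close>
      proof (rule integral_dominated_convergence[where w="\<lambda>x. 3 * norm (f x)"])
        show "AE x in ?M. (\<lambda>i. norm (f x - s i x)) \<longlonglongrightarrow> 0"
          using lim.hyps(2) by (intro AE_I2 tendsto_norm_zero) (auto intro!: tendsto_eq_intros)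
        show "AE x in ?M. norm (norm (f x - s i x)) \<le> 3 * norm (f x)" for i
        proof (intro AE_I2)
          fix x assume "x \<in> space ?M"
          then show "norm (norm (f x - s i x)) \<le> 3 * norm (f x)"
            using lim.hyps(3)[of x i] norm_triangle_ineq4[of "f x" "s i x"] by simp
        qed
      qed (use lim in auto)
      then show "(\<lambda>i. LINT x|?M. norm (f x - s i x)) \<longlonglongrightarrow> 0" by simp
    qed (use lim in auto)
  qed
  then show ?thesis using e unfolding cl_def by blast
qed

section \<open>The exceptional set\<close>

text \<open>Outer regularity adds at most as much as the assumed bound on \<open>A n\<close>, so the
  n-th open set has measure at most \<open>e / 2 ^ (n + 1)\<close>, and these bounds sum to
  \<open>e\<close>.\<close>

lemma unit_leb_open_cover:
  assumes A: "\<And>n. A n \<in> sets unit_leb" "\<And>n. measure unit_leb (A n) \<le> e / 2 ^ (n + 2)" and e: "0 < e"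
  shows "\<exists>U. open U \<and> U \<subseteq> {0<..<1} \<and> (\<forall>n. A n \<subseteq> U) \<and> measure unit_leb U \<le> e"
proof -
  interpret finite_measure unit_leb by (rule finite_measure_unit_leb)
  have "\<exists>T. open T \<and> A n \<subseteq> T \<and> measure unit_leb (T \<inter> {0<..<1}) \<le> e / 2 ^ (n + 1)" for n
  proof -
    have An: "A n \<in> sets lebesgue" "A n \<subseteq> {0<..<1}" using A(1) by (auto simp: sets_unit_leb)
    obtain T where T: "open T" "A n \<subseteq> T" "T - A n \<in> lmeasurable" "emeasure lebesgue (T - A n) < ennreal (e / 2 ^ (n + 2))"
      using sets_lebesgue_outer_open[OF An(1), of "e / 2 ^ (n + 2)"] e by auto
    have TA: "(T - A n) \<inter> {0<..<1} \<in> sets unit_leb"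
      using T(3) by (auto simp: sets_unit_leb fmeasurable_def)
    have "measure unit_leb ((T - A n) \<inter> {0<..<1}) = measure lebesgue ((T - A n) \<inter> {0<..<1})"
      by (rule measure_unit_leb) auto
    also have "\<dots> \<le> measure lebesgue (T - A n)"
      using T(3) TA by (intro measure_mono_fmeasurable) (auto simp: sets_unit_leb)
    also have "\<dots> \<le> e / 2 ^ (n + 2)"
      using T(3,4) e by (simp add: emeasure_eq_measure2 ennreal_less_iff)
    finally have "measure unit_leb ((T - A n) \<inter> {0<..<1}) \<le> e / 2 ^ (n + 2)" .
    moreover have "measure unit_leb (A n \<union> (T - A n) \<inter> {0<..<1})
        \<le> measure unit_leb (A n) + measure unit_leb ((T - A n) \<inter> {0<..<1})"
      using A(1) TA by (intro measure_Un_le)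
    moreover have "A n \<union> (T - A n) \<inter> {0<..<1} = T \<inter> {0<..<1}" using T(2) An(2) by auto
    moreover have "e / 2 ^ (n + 1) = e / 2 ^ (n + 2) + e / 2 ^ (n + 2)" by simp
    ultimately have "measure unit_leb (T \<inter> {0<..<1}) \<le> e / 2 ^ (n + 1)" using A(2)[of n] by simp
    then show ?thesis using T by blast
  qed
  then obtain T where T: "\<And>n. open (T n)" "\<And>n. A n \<subseteq> T n"
    "\<And>n. measure unit_leb (T n \<inter> {0<..<1}) \<le> e / 2 ^ (n + 1)" by metis
  define U where "U = (\<Union>n. T n \<inter> {0<..<1})"
  have sm: "(\<lambda>n. e / 2 ^ (n + 1)) sums e"
    using sums_mult[OF power_half_series, of e] by (simp add: power_divide)
  have sm': "summable (\<lambda>n. measure unit_leb (T n \<inter> {0<..<1}))"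
    using T(3) by (intro summable_comparison_test'[OF sums_summable[OF sm]]) auto
  have "measure unit_leb U \<le> (\<Sum>n. measure unit_leb (T n \<inter> {0<..<1}))"
    unfolding U_def using T(1) sm'
    by (intro finite_measure_subadditive_countably) (auto simp: sets_unit_leb intro!: borel_open)
  also have "\<dots> \<le> (\<Sum>n. e / 2 ^ (n + 1))" by (intro suminf_le T(3) sm' sums_summable[OF sm])
  also have "\<dots> = e" using sm by (simp add: sums_iff)
  finally have "measure unit_leb U \<le> e" .
  moreover have "open U" unfolding U_def using T(1) by (intro open_UN ballI open_Int) auto
  moreover have "U \<subseteq> {0<..<1}" by (auto simp: U_def)
  moreover have "A n \<subseteq> U" for n using T(2)[of n] A(1)[of n] by (auto simp: U_def sets_unit_leb)
  ultimately show ?thesis by blast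
qed

text \<open>Chebyshev's inequality. The summand 1 in \<open>K\<close> keeps it positive when
  \<open>f\<close> is null.\<close>

lemma (in finite_measure) measure_norm_gt_small:
  fixes f :: "'a \<Rightarrow> 'b::{banach, second_countable_topology}"
  assumes f: "integrable M f" and e: "0 < e"
  shows "\<exists>K. measure M {x \<in> space M. K < norm (f x)} \<le> e"
proof -
  define K where "K = (LINT x|M. norm (f x)) / e + 1"
  have K: "0 < K" using e by (auto simp: K_def intro!: add_nonneg_pos)
  have m: "{x \<in> space M. K < norm (f x)} \<in> sets M" using f by measurable
  have "K * measure M {x \<in> space M. K < norm (f x)} = (LINT x|M. K * indicator {x \<in> space M. K < norm (f x)} x)"
    using m by simp
  also have "\<dots> \<le> (LINT x|M. norm (f x))"
    using f K m by (intro integral_mono) (auto simp: emeasure_eq_measure split: split_indicator)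
  also have "\<dots> \<le> K * e" using e by (simp add: K_def distrib_right)
  finally show ?thesis using K by (intro exI[of _ K]) simp
qed

lemma basis_L1_expansion:
  fixes \<phi> \<psi> :: "nat \<Rightarrow> real \<Rightarrow> 'a::{real_normed_field, euclidean_space}"
  assumes p: "1 < p" and basis: "schauder_basis_Lp p \<phi>" and bio: "biorthogonal_system_Lp p \<phi> \<psi>"
  shows "L1_expansion unit_leb \<phi> \<psi>"
proof -
  interpret finite_measure unit_leb by (rule finite_measure_unit_leb)
  have q: "1 \<le> p / (p - 1)" using p by simp
  show ?thesis
  proof
    show "integrable unit_leb (\<phi> n)" for n
      using basis p by (intro integrable_of_Lp[of p]) (auto simp: schauder_basis_Lp_def)
    show "integrable unit_leb (\<psi> n)" for n
      using bio q by (intro integrable_of_Lp[of "p / (p - 1)"]) (auto simp: biorthogonal_system_Lp_def)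
    show "\<exists>E\<in>sets unit_leb. E \<subseteq> A \<and> measure unit_leb E = c * measure unit_leb A"
      if "A \<in> sets unit_leb" "0 \<le> c" "c \<le> 1" for A c
      using that by (rule unit_leb_divisible)
    show "(\<lambda>N. LINT x|unit_leb. norm (partial_sum unit_leb \<phi> \<psi> N h x - h x)) \<longlonglongrightarrow> 0"
      if "h \<in> borel_measurable unit_leb" "\<And>x. norm (h x) \<le> C" for h C
      using p that by (intro partial_sum_converges_L1[OF p basis bio] bounded_in_Lp) auto
  qed
qed

section \<open>Construction of the set \<open>G\<close> and of the corrected functions\<close>

theorem corollary2:
  fixes \<phi> \<psi> :: "nat \<Rightarrow> real \<Rightarrow> 'a::{real_normed_field, euclidean_space}"
    and p \<epsilon> :: real
  assumes "1 < p"
    and "\<And>n. \<phi> n \<in> Linf"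
    and "schauder_basis_Lp p \<phi>"
    and "biorthogonal_system_Lp p \<phi> \<psi>"
    and "\<epsilon> > 0"
  shows "\<exists>G. open G \<and> G \<subseteq> {0<..<1} \<and> measure lebesgue G < \<epsilon> \<and>
           (\<forall>f\<in>Lp 1. \<exists>g\<in>Lp 1.
              has_fourier_series \<psi> g \<and>
              series_converges_Lp 1 \<phi> (fourier_coeff \<psi> g) g \<and>
              {x\<in>{0<..<1}. g x \<noteq> f x} \<subseteq> G)"
proof -
  let ?M = unit_leb
  interpret L1_expansion unit_leb \<phi> \<psi> by (rule basis_L1_expansion) (use assms in auto)
  obtain Q :: "'a set" where Q: "countable Q" "\<And>X. open X \<Longrightarrow> X \<noteq> {} \<Longrightarrow> \<exists>q\<in>Q. q \<in> X"
    using countable_dense_setE by metis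
  define d where "d k = (step_fun (from_nat_into (lists (Q \<times> \<rat>)) k) :: real \<Rightarrow> 'a)" for k
  have d_dense: "\<exists>k. L1 (\<lambda>x. f x - d k x) < e" if f: "integrable ?M f" "0 < e" for f e
  proof -
    obtain l where l: "l \<in> lists (Q \<times> \<rat>)" "L1 (\<lambda>x. f x - step_fun l x) < e"
      using L1_separable[OF Q(2) f] by blast
    have "countable (lists (Q \<times> \<rat>))" using Q(1) by (intro countable_lists countable_SIGMA) (auto intro: countable_rat)
    from from_nat_into_surj[OF this l(1)] l(2) show ?thesis by (auto simp: d_def)
  qed
  have "\<forall>n. \<exists>K. measure ?M {x \<in> space ?M. K < norm (\<psi> n x)} \<le> (\<epsilon> / 4) / 2 ^ (n + 2)"
    using measure_norm_gt_small[OF integrable_\<psi>] assms(5) by simp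
  then obtain K where K: "\<And>n. measure ?M {x \<in> space ?M. K n < norm (\<psi> n x)} \<le> (\<epsilon> / 4) / 2 ^ (n + 2)"
    by metis
  have "\<exists>U. open U \<and> U \<subseteq> {0<..<1} \<and> (\<forall>n. {x \<in> space ?M. K n < norm (\<psi> n x)} \<subseteq> U) \<and> measure ?M U \<le> \<epsilon> / 4"
  proof (rule unit_leb_open_cover[OF _ K])
    show "{x \<in> space ?M. K n < norm (\<psi> n x)} \<in> sets ?M" for n
      using borel_measurable_integrable[OF integrable_\<psi>[of n]] by measurable
  qed (use assms in auto)
  then obtain U where U: "open U" "U \<subseteq> {0<..<1}" "\<And>n. {x \<in> space ?M. K n < norm (\<psi> n x)} \<subseteq> U" "measure ?M U \<le> \<epsilon> / 4"
    by blast
  have Us: "U \<in> sets ?M" using U by (auto simp: sets_unit_leb intro: borel_open)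
  \<comment> \<open>Every \<open>\<psi> n\<close> is bounded on \<open>F\<close>, so products of \<open>\<psi> n\<close> with integrable functions vanishing off \<open>F\<close> are integrable.\<close>
  define F where "F = {0<..<1} - U"
  have Fs: "F \<in> sets ?M" using U(1) by (auto simp: F_def sets_unit_leb intro: borel_open)
  have FK: "norm (\<psi> n x) \<le> K n" if "x \<in> F" for n x
    using that U(3)[of n] by (force simp: F_def)
  \<comment> \<open>Restriction to \<open>F\<close> supplies the boundedness of
    \<open>\<psi> n\<close> on the support that \<open>correction\<close> asks for.\<close>
  define r where "r k x = indicator F x *\<^sub>R d k x" for k x
  have r0: "x \<notin> F \<Longrightarrow> r k x = 0" for k x by (simp add: r_def)
  have rm: "r k \<in> borel_measurable ?M" for k
    unfolding r_def d_def using Fs step_fun_measurable by (intro borel_measurable_scaleR) auto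
  have rb: "\<exists>B. \<forall>x. norm (r k x) \<le> B" for k
  proof -
    obtain B where "\<And>x. norm (d k x) \<le> B" using step_fun_bounded unfolding d_def by blast
    then have "norm (r k x) \<le> B" for x using order_trans[OF norm_ge_zero] by (auto simp: r_def split: split_indicator)
    then show ?thesis by blast
  qed
  have ri: "integrable ?M (r k)" for k using rb[of k] integrable_bounded[OF rm] by blast
  have sp: "measure ?M (space ?M) = 1" by (simp add: measure_unit_leb)
  \<comment> \<open>Summable proportions in the form required by \<open>unit_leb_open_cover\<close>;
    the space has measure 1, so \<open>c k\<close> also bounds the measure of \<open>E k\<close>.
    The minimum with 1 is for \<open>correction\<close>.\<close>
  define c where "c k = min 1 ((\<epsilon> / 4) / 2 ^ (k + 2))" for k :: nat
  have c: "0 < c k" "c k \<le> 1" "c k \<le> (\<epsilon> / 4) / 2 ^ (k + 2)" for k using assms(5) by (auto simp: c_def)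
  define corr where "corr k g E \<longleftrightarrow> g \<in> borel_measurable ?M \<and> (\<exists>C. \<forall>x. norm (g x) \<le> C) \<and> E \<in> sets ?M \<and>
    measure ?M E \<le> c k * measure ?M (space ?M) \<and> (\<forall>x\<in>space ?M - E. g x = r k x) \<and>
    (\<forall>x. r k x = 0 \<longrightarrow> g x = 0) \<and> (\<forall>N. L1 (S N g) \<le> 3 * L1 (r k))" for k g E
  have "\<exists>g E. corr k g E" for k
  proof -
    obtain B where B: "\<And>x. norm (r k x) \<le> B" using rb by blast
    have "\<exists>K. \<forall>x. r k x \<noteq> 0 \<longrightarrow> norm (\<psi> n x) \<le> K" for n
      using FK by (intro exI[of _ "K n"]) (auto simp: r_def indicator_def)
    then show ?thesis unfolding corr_def by (rule correction[OF rm B _ c(1,2)])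
  qed
  then obtain g E where corr: "\<And>k. corr k (g k) (E k)" by metis
  have gm: "g k \<in> borel_measurable ?M" and gb: "\<exists>C. \<forall>x. norm (g k x) \<le> C" and E: "E k \<in> sets ?M" for k
    using corr[of k] unfolding corr_def by blast+
  have Ec: "measure ?M (E k) \<le> c k" for k using corr[of k] unfolding corr_def sp by simp
  have gr: "g k x = r k x" if "x \<in> {0<..<1}" "x \<notin> E k" for k x
    using corr[of k] that unfolding corr_def by simp
  have g0: "g k x = 0" if "r k x = 0" for k x using corr[of k] that unfolding corr_def by blast
  have gS: "L1 (S N (g k)) \<le> 3 * L1 (r k)" for k N using corr[of k] unfolding corr_def by blast
  have "\<exists>V. open V \<and> V \<subseteq> {0<..<1} \<and> (\<forall>k. E k \<subseteq> V) \<and> measure ?M V \<le> \<epsilon> / 4"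
    using assms(5) by (intro unit_leb_open_cover[OF E order_trans[OF Ec c(3)]]) auto
  then obtain V where V: "open V" "V \<subseteq> {0<..<1}" "\<And>k. E k \<subseteq> V" "measure ?M V \<le> \<epsilon> / 4" by blast
  have Vs: "V \<in> sets ?M" using V by (auto simp: sets_unit_leb intro: borel_open)
  \<comment> \<open>\<open>G\<close> is assembled from the corrections of all \<open>r k\<close>
    before any \<open>f\<close> is given, so one set serves every \<open>f\<close>.\<close>
  define G where "G = U \<union> V"
  have Gs: "G \<in> sets ?M" using Us Vs by (auto simp: G_def)
  have "measure ?M G \<le> \<epsilon> / 2" using measure_Un_le[OF Us Vs] U(4) V(4) by (simp add: G_def)
  moreover have "measure ?M G = measure lebesgue G" using U V by (intro measure_unit_leb) (auto simp: G_def)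
  ultimately have "measure lebesgue G < \<epsilon>" using assms(5) by simp
  moreover have "\<exists>g\<in>Lp 1. has_fourier_series \<psi> g \<and> series_converges_Lp 1 \<phi> (fourier_coeff \<psi> g) g \<and>
              {x\<in>{0<..<1}. g x \<noteq> f x} \<subseteq> G" if f: "f \<in> Lp 1" for f
  proof -
    have fi: "integrable ?M f" using integrable_of_Lp[OF _ f] by simp
    define f0 where "f0 x = indicator F x *\<^sub>R f x" for x
    have f0i: "integrable ?M f0" unfolding f0_def using Fs fi by (rule integrable_mult_indicator)
    \<comment> \<open>Greedy approximation: \<open>\<rho> j\<close> is what remains of
      \<open>f0\<close>, and each step subtracts a member of the dense family. The first residual
      \<open>f0\<close> may have any size; the bounds \<open>(1/2) ^ j\<close> start with the
      second.\<close>
    have "\<exists>\<rho>. \<forall>j. (integrable ?M (\<rho> j) \<and> (\<forall>x. x \<notin> F \<longrightarrow> \<rho> j x = 0) \<and> (j = 0 \<longrightarrow> \<rho> j = f0)) \<and>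
       (\<exists>k. \<rho> (Suc j) = (\<lambda>x. \<rho> j x - r k x) \<and> L1 (\<rho> (Suc j)) \<le> (1/2) ^ j)"
    proof (rule dependent_nat_choice)
      show "\<exists>\<rho>. integrable ?M \<rho> \<and> (\<forall>x. x \<notin> F \<longrightarrow> \<rho> x = 0) \<and> (0 = (0::nat) \<longrightarrow> \<rho> = f0)"
        using f0i by (intro exI[of _ f0]) (auto simp: f0_def)
    next
      fix \<rho> and j :: nat
      assume "integrable ?M \<rho> \<and> (\<forall>x. x \<notin> F \<longrightarrow> \<rho> x = 0) \<and> (j = 0 \<longrightarrow> \<rho> = f0)"
      then have \<rho>: "integrable ?M \<rho>" "\<And>x. x \<notin> F \<Longrightarrow> \<rho> x = 0" by auto
      obtain k where k: "L1 (\<lambda>x. \<rho> x - d k x) < (1/2) ^ j" using d_dense[OF \<rho>(1), of "(1/2) ^ j"] by auto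
      have di: "integrable ?M (d k)"
        using step_fun_bounded step_fun_measurable integrable_bounded unfolding d_def by metis
      \<comment> \<open>The residual vanishes off \<open>F\<close>, so cutting \<open>d k\<close>
        down to \<open>F\<close> can only improve the approximation.\<close>
      have "L1 (\<lambda>x. \<rho> x - r k x) \<le> L1 (\<lambda>x. \<rho> x - d k x)"
      proof (rule integral_mono)
        show "norm (\<rho> x - r k x) \<le> norm (\<rho> x - d k x)" for x
          using \<rho>(2)[of x] by (auto simp: r_def split: split_indicator)
      qed (use \<rho>(1) di ri in auto)
      with k have "L1 (\<lambda>x. \<rho> x - r k x) \<le> (1/2) ^ j" by linarith
      moreover have "integrable ?M (\<lambda>x. \<rho> x - r k x)" using \<rho>(1) ri by (rule Bochner_Integration.integrable_diff)
      moreover have "\<rho> x - r k x = 0" if "x \<notin> F" for x using that \<rho>(2) r0 by simp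
      ultimately show "\<exists>\<rho>'. (integrable ?M \<rho>' \<and> (\<forall>x. x \<notin> F \<longrightarrow> \<rho>' x = 0) \<and> (Suc j = 0 \<longrightarrow> \<rho>' = f0)) \<and>
         (\<exists>k. \<rho>' = (\<lambda>x. \<rho> x - r k x) \<and> L1 \<rho>' \<le> (1/2) ^ j)"
        by (intro exI[of _ "\<lambda>x. \<rho> x - r k x"] conjI exI[of _ k] allI impI refl) simp_all
    qed
    then obtain \<rho> where \<rho>i: "\<And>j. integrable ?M (\<rho> j)" and \<rho>0: "\<rho> 0 = f0"
      and "\<forall>j. \<exists>k. \<rho> (Suc j) = (\<lambda>x. \<rho> j x - r k x) \<and> L1 (\<rho> (Suc j)) \<le> (1/2) ^ j" by blast
    then obtain k where \<rho>S: "\<And>j. \<rho> (Suc j) = (\<lambda>x. \<rho> j x - r (k j) x)" and \<rho>L: "\<And>j. L1 (\<rho> (Suc j)) \<le> (1/2) ^ j"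
      by metis
    have s\<rho>': "summable (\<lambda>j. L1 (\<rho> (Suc j)))"
      using \<rho>L by (intro summable_comparison_test'[OF summable_geometric[of "1/2::real"]]) auto
    then have s\<rho>: "summable (\<lambda>j. L1 (\<rho> j))" using summable_Suc_iff[of "\<lambda>j. L1 (\<rho> j)"] by simp
    \<comment> \<open>Each chosen function is the difference of consecutive residuals, so their
      L1-norms inherit summability.\<close>
    have rle: "L1 (r (k j)) \<le> L1 (\<rho> j) + L1 (\<rho> (Suc j))" for j
      using L1_triangle_diff[OF \<rho>i[of j] \<rho>i[of "Suc j"]] by (simp add: \<rho>S)
    have "norm (L1 (r (k j))) \<le> L1 (\<rho> j) + L1 (\<rho> (Suc j))" for j using rle[of j] by simp
    then have "summable (\<lambda>j. L1 (r (k j)))"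
      by (intro summable_comparison_test'[OF summable_add[OF s\<rho> s\<rho>']])
    then have sa: "summable (\<lambda>j. 3 * L1 (r (k j)))" by (rule summable_mult)
    define h where "h x = (\<Sum>j. g (k j) x)" for x
    have gF: "g (k j) x = 0" if "x \<notin> F" for j x using that by (intro g0) (simp add: r_def)
    have gi: "integrable ?M (g (k j))" for j using gb[of "k j"] integrable_bounded[OF gm] by blast
    have gL: "L1 (g (k j)) \<le> 3 * L1 (r (k j))" for j
      using gb[of "k j"] L1_le_of_S_le[OF gm _ gS] by blast
    have hi: "integrable ?M h" unfolding h_def by (rule integrable_suminf_norm[OF gi gL sa])
    have h\<psi>: "integrable ?M (\<lambda>x. h x * \<psi> n x)" for n
      unfolding h_def by (rule integrable_suminf_mult[where g="\<lambda>j. g (k j)", OF gm gb gS sa gF FK])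
    have hS: "(\<lambda>N. L1 (\<lambda>x. S N h x - h x)) \<longlonglongrightarrow> 0"
      unfolding h_def by (rule suminf_converges[where g="\<lambda>j. g (k j)", OF gm gb gS sa gF FK])
    \<comment> \<open>\<open>h\<close> agrees with \<open>f\<close> off \<open>G\<close> only almost
      everywhere, whereas the conclusion demands it at every point. Taking \<open>f\<close> itself
      off \<open>G\<close> repairs this and changes \<open>h\<close> only on a null set, so no
      coefficient changes.\<close>
    define g' where "g' x = (if x \<in> G then h x else f x)" for x
    have g'm: "g' \<in> borel_measurable ?M"
      unfolding g'_def using hi fi Gs by (intro measurable_If_set) auto
    have hf: "AE x in ?M. x \<notin> G \<longrightarrow> h x = f x"
    proof -
      have "AE x in ?M. summable (\<lambda>j. norm (\<rho> j x))"
        using AE_summable_norm[OF \<rho>i order_refl s\<rho>] .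
      then show ?thesis
      proof (rule AE_mp, intro AE_I2 impI)
        fix x assume x: "x \<in> space ?M" "summable (\<lambda>j. norm (\<rho> j x))" "x \<notin> G"
        \<comment> \<open>The sum telescopes, and the residual tends to 0 at points where the norms
          of the residuals are summable. Off \<open>G\<close> a point lies in \<open>F\<close> and
          avoids every exceptional set, so there \<open>f0\<close> is \<open>f\<close> and each
          correction equals its \<open>r (k j)\<close>.\<close>
        have "(\<Sum>j<J. r (k j) x) = f0 x - \<rho> J x" for J
          by (induction J) (auto simp: \<rho>0 \<rho>S)
        moreover have "(\<lambda>J. f0 x - \<rho> J x) \<longlonglongrightarrow> f0 x - 0"
          using summable_LIMSEQ_zero[OF x(2)] by (intro tendsto_intros) (simp add: tendsto_norm_zero_iff)
        ultimately have "(\<lambda>j. r (k j) x) sums f0 x" by (simp add: sums_def)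
        moreover have "r (k j) x = g (k j) x" for j
        proof -
          have "x \<notin> E (k j)" using x(3) V(3)[of "k j"] by (auto simp: G_def)
          then show ?thesis using gr[of x "k j"] x(1) by simp
        qed
        moreover have "f0 x = f x" using x by (simp add: f0_def F_def G_def)
        ultimately show "h x = f x" by (simp add: h_def sums_iff)
      qed
    qed
    then have g'h: "AE x in ?M. g' x = h x" by eventually_elim (auto simp: g'_def)
    have g'i: "integrable ?M g'"
      using integrable_cong_AE[OF g'm _ g'h] hi by auto
    have g'\<psi>: "integrable ?M (\<lambda>x. g' x * \<psi> n x)" for n
    proof -
      have "AE x in ?M. g' x * \<psi> n x = h x * \<psi> n x" using g'h by eventually_elim simp
      moreover have "(\<lambda>x. g' x * \<psi> n x) \<in> borel_measurable ?M"
        using g'm borel_measurable_integrable[OF integrable_\<psi>[of n]] by (rule borel_measurable_times)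
      ultimately show ?thesis
        using integrable_cong_AE[of "\<lambda>x. g' x * \<psi> n x" ?M "\<lambda>x. h x * \<psi> n x"] h\<psi>[of n] by auto
    qed
    have Sg': "S N g' = S N h" for N using g'm hi g'h by (intro S_cong_AE) auto
    have "Lp_norm 1 (\<lambda>x. (\<Sum>n<N. fourier_coeff \<psi> g' n * \<phi> n x) - g' x) = L1 (\<lambda>x. S N h x - h x)" for N
    proof -
      have "Lp_norm 1 (\<lambda>x. (\<Sum>n<N. fourier_coeff \<psi> g' n * \<phi> n x) - g' x) = L1 (\<lambda>x. S N h x - g' x)"
        unfolding Sg'[symmetric] by (simp add: Lp_norm_def partial_sum_def fourier_coeff_def)
      also have "\<dots> = L1 (\<lambda>x. S N h x - h x)"
      proof (rule integral_cong_AE)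
        have "integrable ?M (\<lambda>x. S N h x - g' x)" "integrable ?M (\<lambda>x. S N h x - h x)" using g'i hi by auto
        then show "(\<lambda>x. norm (S N h x - g' x)) \<in> borel_measurable ?M"
          "(\<lambda>x. norm (S N h x - h x)) \<in> borel_measurable ?M" by auto
        show "AE x in ?M. norm (S N h x - g' x) = norm (S N h x - h x)" using g'h by eventually_elim simp
      qed
      finally show ?thesis .
    qed
    then have "series_converges_Lp 1 \<phi> (fourier_coeff \<psi> g') g'"
      using hS by (simp add: series_converges_Lp_def)
    moreover have "g' \<in> Lp 1" using g'm g'i by (simp add: Lp_def)
    moreover have "has_fourier_series \<psi> g'" using g'\<psi> by (simp add: has_fourier_series_def)
    moreover have "{x\<in>{0<..<1}. g' x \<noteq> f x} \<subseteq> G" by (auto simp: g'_def)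
    ultimately show ?thesis by blast
  qed
  moreover have "open G" "G \<subseteq> {0<..<1}" using U V by (auto simp: G_def)
  ultimately show ?thesis by blast
qed

end
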